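(* Suppose that $\Lambda$ is an acyclic $k$-graph. If $G$ is a discrete group acting freely on $\Lambda$, then $H_*(\Lambda/G)\cong H_*(G,\mathbb{Z})$, i.e. $H_r(\Lambda/G)\cong H_r(G,\mathbb{Z})$ for every $r\ge0$, where $H_*(G,\mathbb{Z})$ is the group homology of $G$ with coefficients in the trivial module $\mathbb{Z}$.
   Context: Conventions: $0\in\mathbb{N}$ and $\mathbb{N}^0=\{0\}$. A $k$-graph ($k\ge0$) is a nonempty countable small category $\Lambda$ with a functor $d:\Lambda\to\mathbb{N}^k$ (the degree) satisfying the factorisation property: whenever $d(\lambda)=m+n$ there are unique $\mu,\nu\in\Lambda$ with $d(\mu)=m$, $d(\nu)=n$, $\lambda=\mu\nu$. Objects are identified with identity morphisms; $\Lambda^n=d^{-1}(n)$; $r,s:\Lambda\to\Lambda^0$ are the codomain and domain maps, and $\mu\nu$ is defined when $s(\mu)=r(\nu)$. $e_1,\dots,e_k$ are the standard generators of $\mathbb{N}^k$, $\mathbf{1}_k=\sum_i e_i$, $\le$ on $\mathbb{N}^k$ is coordinatewise, $|n|=\sum_i n_i$. A group $G$ acts on $\Lambda$ by $k$-graph automorphisms (degree-preserving invertible functors); the action is free if $g\lambda=\lambda$ for some $\lambda\in\Lambda$ implies $g=1$ (equivalently, $G$ acts freely on $\Lambda^0$). For a free action the quotient $\Lambda/G$ is the $k$-graph whose morphisms are the $G$-orbits $[\lambda]$, with $r([\lambda])=[r(\lambda)]$, $s([\lambda])=[s(\lambda)]$, $d([\lambda])=d(\lambda)$ and $[\lambda][\mu]=[\lambda\mu]$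 whenever representatives are chosen with $s(\lambda)=r(\mu)$. Homology: $Q_r(\Lambda)=\{\lambda\in\Lambda: d(\lambda)\le\mathbf{1}_k,\ |d(\lambda)|=r\}$. For $\lambda\in Q_r(\Lambda)$ with $d(\lambda)=e_{i_1}+\dots+e_{i_r}$, $i_1<\dots<i_r$, and $1\le j\le r$, the faces $F_j^0(\lambda),F_j^1(\lambda)\in Q_{r-1}(\Lambda)$ are the unique elements for which there are $\alpha,\beta\in\Lambda^{e_{i_j}}$ with $F_j^0(\lambda)\beta=\lambda=\alpha F_j^1(\lambda)$. $C_r(\Lambda)=\mathbb{Z}Q_r(\Lambda)$ is the free abelian group on $Q_r(\Lambda)$; for $r\ge1$, $\partial_r:C_r(\Lambda)\to C_{r-1}(\Lambda)$ is the homomorphism with $\partial_r(\lambda)=\sum_{\ell=0}^1\sum_{i=1}^r(-1)^{i+\ell}F_i^\ell(\lambda)$, and $\partial_0=0$. This is a chain complex and $H_r(\Lambda)=\ker\partial_r/\operatorname{Im}\partial_{r+1}$. $\Lambda$ is acyclic if $H_0(\Lambda)\cong\mathbb{Z}$ and $H_r(\Lambda)=0$ for all $r\ge1$. *)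

theory Defs
  imports "HOL-Algebra.Free_Abelian_Groups" "HOL-Algebra.Group_Action" "HOL-Library.Function_Algebras"
begin

section \<open>Higher-rank graphs\<close>

text \<open>
  Elements of $\mathbb{N}^k$ are functions on the naturals supported on the coordinates
  $1,\ldots,k$, so that $k$ is an ordinary natural number, possibly $0$. Addition is pointwise
  and the order is the pointwise one.
\<close>

definition Nk :: "nat \<Rightarrow> (nat \<Rightarrow> nat) set" where
  "Nk k = {n. \<forall>i. i \<notin> {1..k} \<longrightarrow> n i = 0}"

definition unit_deg :: "nat \<Rightarrow> nat \<Rightarrow> nat" where
  "unit_deg i = (\<lambda>j. if j = i then 1 else 0)"

definition ones :: "nat \<Rightarrow> nat \<Rightarrow> nat" where
  "ones k = (\<lambda>j. if j \<in> {1..k} then 1 else 0)"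

definition deg_size :: "nat \<Rightarrow> (nat \<Rightarrow> nat) \<Rightarrow> nat" where
  "deg_size k n = (\<Sum>i = 1..k. n i)"

text \<open>
  A small category is given by its set of morphisms alone, objects being identified with
  their identity morphisms; the codomain and domain maps \<open>rng\<close> and \<open>src\<close> therefore take
  values in morphisms. The value \<open>cmp \<Lambda> \<mu> \<nu>\<close> is meaningful only if \<open>src \<Lambda> \<mu> = rng \<Lambda> \<nu>\<close>.
\<close>

record 'a kgraph =
  mor :: "'a set"
  deg :: "'a \<Rightarrow> nat \<Rightarrow> nat"
  rng :: "'a \<Rightarrow> 'a"
  src :: "'a \<Rightarrow> 'a"
  cmp :: "'a \<Rightarrow> 'a \<Rightarrow> 'a"

locale kgraph =
  fixes k :: nat and \<Lambda> :: "'a kgraph"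
  assumes nonempty: "mor \<Lambda> \<noteq> {}"
    and countable: "countable (mor \<Lambda>)"
    and rng_mor: "\<xi> \<in> mor \<Lambda> \<Longrightarrow> rng \<Lambda> \<xi> \<in> mor \<Lambda>"
    and src_mor: "\<xi> \<in> mor \<Lambda> \<Longrightarrow> src \<Lambda> \<xi> \<in> mor \<Lambda>"
    and rng_rng: "\<xi> \<in> mor \<Lambda> \<Longrightarrow> rng \<Lambda> (rng \<Lambda> \<xi>) = rng \<Lambda> \<xi>"
    and src_rng: "\<xi> \<in> mor \<Lambda> \<Longrightarrow> src \<Lambda> (rng \<Lambda> \<xi>) = rng \<Lambda> \<xi>"
    and rng_src: "\<xi> \<in> mor \<Lambda> \<Longrightarrow> rng \<Lambda> (src \<Lambda> \<xi>) = src \<Lambda> \<xi>"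
    and src_src: "\<xi> \<in> mor \<Lambda> \<Longrightarrow> src \<Lambda> (src \<Lambda> \<xi>) = src \<Lambda> \<xi>"
    and cmp_mor: "\<lbrakk>\<mu> \<in> mor \<Lambda>; \<nu> \<in> mor \<Lambda>; src \<Lambda> \<mu> = rng \<Lambda> \<nu>\<rbrakk> \<Longrightarrow> cmp \<Lambda> \<mu> \<nu> \<in> mor \<Lambda>"
    and rng_cmp: "\<lbrakk>\<mu> \<in> mor \<Lambda>; \<nu> \<in> mor \<Lambda>; src \<Lambda> \<mu> = rng \<Lambda> \<nu>\<rbrakk>
                    \<Longrightarrow> rng \<Lambda> (cmp \<Lambda> \<mu> \<nu>) = rng \<Lambda> \<mu>"
    and src_cmp: "\<lbrakk>\<mu> \<in> mor \<Lambda>; \<nu> \<in> mor \<Lambda>; src \<Lambda> \<mu> = rng \<Lambda> \<nu>\<rbrakk>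
                    \<Longrightarrow> src \<Lambda> (cmp \<Lambda> \<mu> \<nu>) = src \<Lambda> \<nu>"
    and cmp_assoc: "\<lbrakk>\<xi> \<in> mor \<Lambda>; \<mu> \<in> mor \<Lambda>; \<nu> \<in> mor \<Lambda>;
                      src \<Lambda> \<xi> = rng \<Lambda> \<mu>; src \<Lambda> \<mu> = rng \<Lambda> \<nu>\<rbrakk>
                    \<Longrightarrow> cmp \<Lambda> (cmp \<Lambda> \<xi> \<mu>) \<nu> = cmp \<Lambda> \<xi> (cmp \<Lambda> \<mu> \<nu>)"
    and cmp_rng_left: "\<xi> \<in> mor \<Lambda> \<Longrightarrow> cmp \<Lambda> (rng \<Lambda> \<xi>) \<xi> = \<xi>"
    and cmp_src_right: "\<xi> \<in> mor \<Lambda> \<Longrightarrow> cmp \<Lambda> \<xi> (src \<Lambda> \<xi>) = \<xi>"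
    and deg_Nk: "\<xi> \<in> mor \<Lambda> \<Longrightarrow> deg \<Lambda> \<xi> \<in> Nk k"
    and deg_rng: "\<xi> \<in> mor \<Lambda> \<Longrightarrow> deg \<Lambda> (rng \<Lambda> \<xi>) = 0"
    and deg_cmp: "\<lbrakk>\<mu> \<in> mor \<Lambda>; \<nu> \<in> mor \<Lambda>; src \<Lambda> \<mu> = rng \<Lambda> \<nu>\<rbrakk>
                    \<Longrightarrow> deg \<Lambda> (cmp \<Lambda> \<mu> \<nu>) = deg \<Lambda> \<mu> + deg \<Lambda> \<nu>"
    and factorisation: "\<lbrakk>\<xi> \<in> mor \<Lambda>; m \<in> Nk k; n \<in> Nk k; deg \<Lambda> \<xi> = m + n\<rbrakk>
                    \<Longrightarrow> \<exists>!(\<mu>, \<nu>). \<mu> \<in> mor \<Lambda> \<and> \<nu> \<in> mor \<Lambda> \<and> deg \<Lambda> \<mu> = m \<and> deg \<Lambda> \<nu> = n \<and>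
                          src \<Lambda> \<mu> = rng \<Lambda> \<nu> \<and> \<xi> = cmp \<Lambda> \<mu> \<nu>"


section \<open>Actions and quotients\<close>

locale kgraph_action =
  kgraph k \<Lambda> + group_action G "mor \<Lambda>" \<phi>
  for k :: nat and \<Lambda> :: "'a kgraph" and G :: "('g, 'b) monoid_scheme" (structure)
    and \<phi> :: "'g \<Rightarrow> 'a \<Rightarrow> 'a" +
  assumes act_deg: "\<lbrakk>g \<in> carrier G; \<xi> \<in> mor \<Lambda>\<rbrakk> \<Longrightarrow> deg \<Lambda> (\<phi> g \<xi>) = deg \<Lambda> \<xi>"
    and act_rng: "\<lbrakk>g \<in> carrier G; \<xi> \<in> mor \<Lambda>\<rbrakk> \<Longrightarrow> rng \<Lambda> (\<phi> g \<xi>) = \<phi> g (rng \<Lambda> \<xi>)"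
    and act_src: "\<lbrakk>g \<in> carrier G; \<xi> \<in> mor \<Lambda>\<rbrakk> \<Longrightarrow> src \<Lambda> (\<phi> g \<xi>) = \<phi> g (src \<Lambda> \<xi>)"
    and act_cmp: "\<lbrakk>g \<in> carrier G; \<mu> \<in> mor \<Lambda>; \<nu> \<in> mor \<Lambda>; src \<Lambda> \<mu> = rng \<Lambda> \<nu>\<rbrakk>
                    \<Longrightarrow> \<phi> g (cmp \<Lambda> \<mu> \<nu>) = cmp \<Lambda> (\<phi> g \<mu>) (\<phi> g \<nu>)"

locale free_kgraph_action = kgraph_action +
  assumes free: "\<lbrakk>g \<in> carrier G; \<xi> \<in> mor \<Lambda>; \<phi> g \<xi> = \<xi>\<rbrakk> \<Longrightarrow> g = \<one>"

text \<open>
  The structure of $\Lambda/G$ is defined setwise on orbits, without choosing representatives;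
  the lemmas below give its description in terms of representatives.
\<close>

definition kgraph_quotient ::
    "'a kgraph \<Rightarrow> ('g, 'b) monoid_scheme \<Rightarrow> ('g \<Rightarrow> 'a \<Rightarrow> 'a) \<Rightarrow> 'a set kgraph" where
  "kgraph_quotient \<Lambda> G \<phi> =
     \<lparr>mor = orbits G (mor \<Lambda>) \<phi>,
      deg = (\<lambda>X. the_elem (deg \<Lambda> ` X)),
      rng = (\<lambda>X. rng \<Lambda> ` X),
      src = (\<lambda>X. src \<Lambda> ` X),
      cmp = (\<lambda>X Y. {cmp \<Lambda> \<mu> \<nu> | \<mu> \<nu>. \<mu> \<in> X \<and> \<nu> \<in> Y \<and> src \<Lambda> \<mu> = rng \<Lambda> \<nu>})\<rparr>"

context kgraph_action
begin

lemma deg_orbit: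
  assumes "\<xi> \<in> mor \<Lambda>"
  shows "deg (kgraph_quotient \<Lambda> G \<phi>) (orbit G \<phi> \<xi>) = deg \<Lambda> \<xi>"
proof -
  have "\<one> \<in> carrier G"
    using group_hom group_hom.axioms(1) group.is_monoid monoid.one_closed by blast
  then have "deg \<Lambda> ` orbit G \<phi> \<xi> = {deg \<Lambda> \<xi>}"
    using assms act_deg by (auto simp: orbit_def image_def)
  then show ?thesis
    by (simp add: kgraph_quotient_def)
qed

lemma rng_orbit:
  assumes "\<xi> \<in> mor \<Lambda>"
  shows "rng (kgraph_quotient \<Lambda> G \<phi>) (orbit G \<phi> \<xi>) = orbit G \<phi> (rng \<Lambda> \<xi>)"
  using assms act_rng by (auto simp: orbit_def kgraph_quotient_def image_def)

lemma src_orbit: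
  assumes "\<xi> \<in> mor \<Lambda>"
  shows "src (kgraph_quotient \<Lambda> G \<phi>) (orbit G \<phi> \<xi>) = orbit G \<phi> (src \<Lambda> \<xi>)"
  using assms act_src by (auto simp: orbit_def kgraph_quotient_def image_def)

end

lemma (in free_kgraph_action) cmp_orbit:
  assumes mem: "\<mu> \<in> mor \<Lambda>" "\<nu> \<in> mor \<Lambda>" and st: "src \<Lambda> \<mu> = rng \<Lambda> \<nu>"
  shows "cmp (kgraph_quotient \<Lambda> G \<phi>) (orbit G \<phi> \<mu>) (orbit G \<phi> \<nu>) = orbit G \<phi> (cmp \<Lambda> \<mu> \<nu>)"
proof -
  have eq: "g = h" if g: "g \<in> carrier G" and h: "h \<in> carrier G"
    and s: "src \<Lambda> (\<phi> g \<mu>) = rng \<Lambda> (\<phi> h \<nu>)" for g h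
  proof -
    interpret G: group G
      using group_hom group_hom.axioms(1) by blast
    let ?v = "rng \<Lambda> \<nu>"
    have v: "?v \<in> mor \<Lambda>" using mem rng_mor by simp
    have "\<phi> g ?v = \<phi> h ?v"
      using s g h mem st by (simp add: act_src act_rng)
    then have "\<phi> (inv h \<otimes> g) ?v = ?v"
      using composition_rule[OF v, of "inv h" g] orbit_sym_aux[OF h v] g h by simp
    then have "inv h \<otimes> g = \<one>"
      using free[OF _ v, of "inv h \<otimes> g"] g h by simp
    then show ?thesis
      using g h G.inv_equality G.inv_inv G.inv_closed by metis
  qed
  show ?thesis (is "?L = ?R")
  proof
    show "?L \<subseteq> ?R"
    proof
      fix x assume "x \<in> ?L"
      then obtain g h where g: "g \<in> carrier G" and h: "h \<in> carrier G"
        and s: "src \<Lambda> (\<phi> g \<mu>) = rng \<Lambda> (\<phi> h \<nu>)" and x: "x = cmp \<Lambda> (\<phi> g \<mu>) (\<phi> h \<nu>)"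
        by (auto simp: kgraph_quotient_def orbit_def)
      then have "x = \<phi> g (cmp \<Lambda> \<mu> \<nu>)"
        using eq[OF g h s] act_cmp[OF g mem st] by simp
      then show "x \<in> ?R" using g by (auto simp: orbit_def)
    qed
    show "?R \<subseteq> ?L"
    proof
      fix x assume "x \<in> ?R"
      then obtain g where g: "g \<in> carrier G" and x: "x = cmp \<Lambda> (\<phi> g \<mu>) (\<phi> g \<nu>)"
        using act_cmp mem st by (auto simp: orbit_def)
      moreover have "src \<Lambda> (\<phi> g \<mu>) = rng \<Lambda> (\<phi> g \<nu>)"
        using g mem st by (simp add: act_src act_rng)
      ultimately show "x \<in> ?L"
        using g x by (auto simp: kgraph_quotient_def orbit_def)
    qed
  qed
qed


section \<open>Homology of complexes of based free abelian groups\<close>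

text \<open>
  The complex has chain group the free abelian group on \<open>B r\<close> in degree \<open>r\<close>, and
  \<open>bd r b\<close> is the boundary of the basis element \<open>b\<close> of \<open>B r\<close>, extended linearly.
  In degree $0$ the boundaries below vanish, so that all $0$-chains are cycles.
\<close>

definition chain_cycles ::
    "(nat \<Rightarrow> 'c set) \<Rightarrow> (nat \<Rightarrow> 'c \<Rightarrow> 'c \<Rightarrow>\<^sub>0 int) \<Rightarrow> nat \<Rightarrow> ('c \<Rightarrow>\<^sub>0 int) set" where
  "chain_cycles B bd r = {c \<in> carrier (free_Abelian_group (B r)). frag_extend (bd r) c = 0}"

definition chain_boundaries ::
    "(nat \<Rightarrow> 'c set) \<Rightarrow> (nat \<Rightarrow> 'c \<Rightarrow> 'c \<Rightarrow>\<^sub>0 int) \<Rightarrow> nat \<Rightarrow> ('c \<Rightarrow>\<^sub>0 int) set" where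
  "chain_boundaries B bd r =
     frag_extend (bd (Suc r)) ` carrier (free_Abelian_group (B (Suc r)))"

definition chain_homology ::
    "(nat \<Rightarrow> 'c set) \<Rightarrow> (nat \<Rightarrow> 'c \<Rightarrow> 'c \<Rightarrow>\<^sub>0 int) \<Rightarrow> nat \<Rightarrow> ('c \<Rightarrow>\<^sub>0 int) set monoid" where
  "chain_homology B bd r =
     subgroup_generated (free_Abelian_group (B r)) (chain_cycles B bd r)
       Mod chain_boundaries B bd r"


section \<open>Homology of higher-rank graphs\<close>

definition cubes :: "nat \<Rightarrow> 'a kgraph \<Rightarrow> nat \<Rightarrow> 'a set" where
  "cubes k \<Lambda> r = {\<xi> \<in> mor \<Lambda>. deg \<Lambda> \<xi> \<le> ones k \<and> deg_size k (deg \<Lambda> \<xi>) = r}"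

text \<open>
  For a cube \<open>\<xi>\<close> of degree $e_{i_1} + \cdots + e_{i_r}$ with $i_1 < \cdots < i_r$,
  \<open>cube_dir \<Lambda> \<xi> j\<close> is $i_j$, where $1 \le j \le r$.
\<close>

definition cube_dir :: "'a kgraph \<Rightarrow> 'a \<Rightarrow> nat \<Rightarrow> nat" where
  "cube_dir \<Lambda> \<xi> j = sorted_list_of_set {i. deg \<Lambda> \<xi> i \<noteq> 0} ! (j - 1)"

definition face0 :: "nat \<Rightarrow> 'a kgraph \<Rightarrow> nat \<Rightarrow> nat \<Rightarrow> 'a \<Rightarrow> 'a" where
  "face0 k \<Lambda> r j \<xi> =
     (THE \<mu>. \<mu> \<in> cubes k \<Lambda> (r - 1) \<and>
        (\<exists>\<beta> \<in> mor \<Lambda>. deg \<Lambda> \<beta> = unit_deg (cube_dir \<Lambda> \<xi> j) \<and> src \<Lambda> \<mu> = rng \<Lambda> \<beta> \<and>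
           \<xi> = cmp \<Lambda> \<mu> \<beta>))"

definition face1 :: "nat \<Rightarrow> 'a kgraph \<Rightarrow> nat \<Rightarrow> nat \<Rightarrow> 'a \<Rightarrow> 'a" where
  "face1 k \<Lambda> r j \<xi> =
     (THE \<nu>. \<nu> \<in> cubes k \<Lambda> (r - 1) \<and>
        (\<exists>\<alpha> \<in> mor \<Lambda>. deg \<Lambda> \<alpha> = unit_deg (cube_dir \<Lambda> \<xi> j) \<and> src \<Lambda> \<alpha> = rng \<Lambda> \<nu> \<and>
           \<xi> = cmp \<Lambda> \<alpha> \<nu>))"

definition face :: "nat \<Rightarrow> 'a kgraph \<Rightarrow> nat \<Rightarrow> nat \<Rightarrow> nat \<Rightarrow> 'a \<Rightarrow> 'a" where
  "face k \<Lambda> r l = (if l = 0 then face0 k \<Lambda> r else face1 k \<Lambda> r)"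

definition cube_boundary :: "nat \<Rightarrow> 'a kgraph \<Rightarrow> nat \<Rightarrow> 'a \<Rightarrow> 'a \<Rightarrow>\<^sub>0 int" where
  "cube_boundary k \<Lambda> r \<xi> =
     (\<Sum>l = 0..1. \<Sum>i = 1..r. frag_cmul ((-1) ^ (i + l)) (frag_of (face k \<Lambda> r l i \<xi>)))"

definition kgraph_homology :: "nat \<Rightarrow> 'a kgraph \<Rightarrow> nat \<Rightarrow> ('a \<Rightarrow>\<^sub>0 int) set monoid" where
  "kgraph_homology k \<Lambda> = chain_homology (cubes k \<Lambda>) (cube_boundary k \<Lambda>)"

definition kgraph_acyclic :: "nat \<Rightarrow> 'a kgraph \<Rightarrow> bool" where
  "kgraph_acyclic k \<Lambda> \<longleftrightarrow>
     kgraph_homology k \<Lambda> 0 \<cong> integer_group \<and> (\<forall>r\<ge>1. trivial_group (kgraph_homology k \<Lambda> r))"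


section \<open>Group homology with trivial integer coefficients\<close>

text \<open>
  The bar resolution of the trivial module $\mathbb{Z}$ is, in degree $n$, the free
  $\mathbb{Z}G$-module on the symbols $[g_1|\cdots|g_n]$, with boundary
  $$g_1 [g_2|\cdots|g_n] + \sum_{i=1}^{n-1} (-1)^i [g_1|\cdots|g_i g_{i+1}|\cdots|g_n]
    + (-1)^n [g_1|\cdots|g_{n-1}].$$
  Applying $\mathbb{Z} \otimes_{\mathbb{Z}G} -$ gives the complex below, whose homology is
  $H_*(G,\mathbb{Z})$; the symbol $[g_1|\cdots|g_n]$ is the list of the $g_i$.
\<close>

definition bar_basis :: "('g, 'b) monoid_scheme \<Rightarrow> nat \<Rightarrow> 'g list set" where
  "bar_basis G n = {gs. length gs = n \<and> set gs \<subseteq> carrier G}"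

definition bar_merge :: "('g, 'b) monoid_scheme \<Rightarrow> nat \<Rightarrow> 'g list \<Rightarrow> 'g list" where
  "bar_merge G i gs = take (i - 1) gs @ (gs ! (i - 1) \<otimes>\<^bsub>G\<^esub> gs ! i) # drop (i + 1) gs"

definition bar_boundary :: "('g, 'b) monoid_scheme \<Rightarrow> nat \<Rightarrow> 'g list \<Rightarrow> 'g list \<Rightarrow>\<^sub>0 int" where
  "bar_boundary G n gs =
     (if n = 0 then 0
      else frag_of (tl gs)
         + (\<Sum>i = 1..n - 1. frag_cmul ((-1) ^ i) (frag_of (bar_merge G i gs)))
         + frag_cmul ((-1) ^ n) (frag_of (butlast gs)))"

definition group_homology :: "('g, 'b) monoid_scheme \<Rightarrow> nat \<Rightarrow> ('g list \<Rightarrow>\<^sub>0 int) set monoid" where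
  "group_homology G = chain_homology (bar_basis G) (bar_boundary G)"

end

theory Submission
  imports Defs
begin

text \<open>
  Two free resolutions of the same module are equivariantly homotopy equivalent, and an equivariant
  homotopy equivalence survives the passage to coinvariants. Both sides of the theorem are of this
  kind. The cubical chain complex of $\Lambda$ is a complex of free $\mathbb{Z}G$-modules because $G$
  permutes the cubes freely, and it resolves $\mathbb{Z}$ because $\Lambda$ is acyclic; its
  coinvariants are the cubical complex of $\Lambda/G$. The bar complex is the complex of coinvariants
  of the bar resolution.

  A free $\mathbb{Z}G$-module is represented by a set on which $G$ acts freely, and the module of
  coinvariants by any surjection whose fibres are the orbits. The locale \<open>free_resolution\<close>
  describes an augmented exact complex of such modules and \<open>free_resolution_coinvariants\<close> adds the
  quotient. The comparison theorem is \<open>coinvariant_homology_unique\<close>; it rests on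
  \<open>ex_equivariant_chain_map\<close> and \<open>ex_equivariant_null_homotopy\<close>, which construct equivariant maps
  degree by degree, choosing values on orbit representatives with the help of \<open>equivariant_choice\<close>.

  That the bar resolution qualifies is \<open>bar_coinvariants\<close>: prefixing the unit to a tuple is a
  contracting homotopy, and it gives both exactness and $\partial\partial = 0$.

  That the cubes qualify is \<open>cube_coinvariants\<close>. Every face of a cube is a middle factor of it in a
  three-fold factorisation, and is determined by the degrees of the factors. So faces in distinct
  directions commute, which gives $\partial\partial = 0$, and faces are compatible with the action and
  with the orbit map. In degree $0$ an abstract isomorphism $H_0(\Lambda) \cong \mathbb{Z}$ is all that
  acyclicity provides; since $H_0(\Lambda)$ is then cyclic and the augmentation is not zero on it, the
  augmentation is injective on $H_0(\Lambda)$, which is exactness at degree $0$ (\<open>acyclic_exact\<close>).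
\<close>

section \<open>Chains\<close>

definition int_chains :: "'c set \<Rightarrow> ('c \<Rightarrow>\<^sub>0 int) set" where
  "int_chains S = carrier (free_Abelian_group S)"

text \<open>
  The homomorphism of free abelian groups induced by a map of the bases.
\<close>
definition push :: "('c \<Rightarrow> 'd) \<Rightarrow> ('c \<Rightarrow>\<^sub>0 int) \<Rightarrow> ('d \<Rightarrow>\<^sub>0 int)" where
  "push p = frag_extend (frag_of \<circ> p)"

lemma chains_zero [simp]: "0 \<in> int_chains S"
  and chains_frag_of [simp]: "frag_of x \<in> int_chains S \<longleftrightarrow> x \<in> S"
  by (simp_all add: int_chains_def)

lemma chains_add: "c \<in> int_chains S \<Longrightarrow> d \<in> int_chains S \<Longrightarrow> c + d \<in> int_chains S"
  using Poly_Mapping.keys_add[of c d] by (auto simp: int_chains_def)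

lemma chains_diff: "c \<in> int_chains S \<Longrightarrow> d \<in> int_chains S \<Longrightarrow> c - d \<in> int_chains S"
  using keys_diff[of c d] by (auto simp: int_chains_def)

lemma chains_cmul: "c \<in> int_chains S \<Longrightarrow> frag_cmul k c \<in> int_chains S"
  using keys_cmul[of k c] by (auto simp: int_chains_def)

lemma chains_sum: "(\<And>i. i \<in> I \<Longrightarrow> f i \<in> int_chains S) \<Longrightarrow> sum f I \<in> int_chains S"
  by (induction I rule: infinite_finite_induct) (auto intro: chains_add)

lemma chains_frag_extend:
  assumes "c \<in> int_chains S" "\<And>x. x \<in> S \<Longrightarrow> f x \<in> int_chains S'"
  shows "frag_extend f c \<in> int_chains S'"
  using keys_frag_extend[of f c] assms by (fastforce simp: int_chains_def)

lemma chains_push: "c \<in> int_chains S \<Longrightarrow> (\<And>x. x \<in> S \<Longrightarrow> p x \<in> S') \<Longrightarrow> push p c \<in> int_chains S'"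
  unfolding push_def by (rule chains_frag_extend) auto

lemma frag_extend_cong_chains:
  "c \<in> int_chains S \<Longrightarrow> (\<And>x. x \<in> S \<Longrightarrow> f x = g x) \<Longrightarrow> frag_extend f c = frag_extend g c"
  by (rule frag_extend_eq) (auto simp: int_chains_def)

lemma frag_extend_zero_chains:
  "c \<in> int_chains S \<Longrightarrow> (\<And>x. x \<in> S \<Longrightarrow> f x = 0) \<Longrightarrow> frag_extend f c = 0"
  by (rule frag_extend_eq_0) (auto simp: int_chains_def)

lemma frag_extend_frag_extend:
  "frag_extend f (frag_extend g c) = frag_extend (\<lambda>x. frag_extend f (g x)) c"
  using subset_UNIV[of "Poly_Mapping.keys c"]
  by (induction c rule: frag_induction) (auto simp: frag_extend_diff)

lemma frag_extend_push: "frag_extend f (push p c) = frag_extend (\<lambda>x. f (p x)) c"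
  by (simp add: push_def frag_extend_frag_extend)

lemma push_frag_extend: "push p (frag_extend f c) = frag_extend (\<lambda>x. push p (f x)) c"
  by (simp add: push_def frag_extend_frag_extend)

lemma push_push: "push p (push q c) = push (\<lambda>x. p (q x)) c"
  by (simp add: push_def frag_extend_frag_extend o_def)

lemma push_cong_chains:
  "c \<in> int_chains S \<Longrightarrow> (\<And>x. x \<in> S \<Longrightarrow> p x = q x) \<Longrightarrow> push p c = push q c"
  unfolding push_def by (rule frag_extend_cong_chains) auto

lemma frag_extend_fun_diff: "frag_extend (\<lambda>x. f x - g x) c = frag_extend f c - frag_extend g c"
  using subset_UNIV[of "Poly_Mapping.keys c"]
  by (induction c rule: frag_induction) (auto simp: frag_extend_diff)

lemma frag_extend_frag_of [simp]: "frag_extend frag_of c = c"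
  using frag_expansion[of c] by simp

lemma push_ident [simp]: "push (\<lambda>x. x) c = c"
  by (simp add: push_def o_def)

lemma push_zero [simp]: "push p 0 = 0"
  and push_frag_of [simp]: "push p (frag_of x) = frag_of (p x)"
  and push_add: "push p (c + d) = push p c + push p d"
  and push_diff: "push p (c - d) = push p c - push p d"
  and push_minus: "push p (- c) = - push p c"
  and push_cmul: "push p (frag_cmul k c) = frag_cmul k (push p c)"
  by (simp_all add: push_def frag_extend_add frag_extend_diff frag_extend_minus frag_extend_cmul)

lemma push_sum: "push p (sum f I) = (\<Sum>i\<in>I. push p (f i))"
  by (induction I rule: infinite_finite_induct) (auto simp: push_add)

lemma chains_image_push:
  assumes "p ` S = T" "c \<in> int_chains T"
  obtains c' where "c' \<in> int_chains S" "c = push p c'"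
proof -
  have inv: "inv_into S p t \<in> S" "p (inv_into S p t) = t" if "t \<in> T" for t
    using that assms(1) by (auto simp: inv_into_into f_inv_into_f)
  have "push p (push (inv_into S p) c) = c"
    using push_cong_chains[OF assms(2), of "\<lambda>t. p (inv_into S p t)" "\<lambda>t. t"] inv
    by (simp add: push_push)
  moreover have "push (inv_into S p) c \<in> int_chains S"
    using assms(2) inv by (auto intro: chains_push)
  ultimately show ?thesis using that by metis
qed

section \<open>Homology of based complexes\<close>

lemma chain_cycles_iff: "c \<in> chain_cycles B bd r \<longleftrightarrow> c \<in> int_chains (B r) \<and> frag_extend (bd r) c = 0"
  by (simp add: chain_cycles_def int_chains_def)

lemma chain_boundaries_eq: "chain_boundaries B bd r = frag_extend (bd (Suc r)) ` int_chains (B (Suc r))"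
  by (simp add: chain_boundaries_def int_chains_def)

lemma subgroup_chains:
  assumes "Z \<subseteq> int_chains S" "0 \<in> Z" "\<And>c d. c \<in> Z \<Longrightarrow> d \<in> Z \<Longrightarrow> c - d \<in> Z"
  shows "subgroup Z (free_Abelian_group S)"
proof (rule group.subgroupI)
  show "group (free_Abelian_group S)" by simp
  show "Z \<subseteq> carrier (free_Abelian_group S)" using assms(1) by (simp add: int_chains_def)
  show "Z \<noteq> {}" using assms(2) by auto
  have minus: "- c \<in> Z" if "c \<in> Z" for c
    using assms(3)[OF assms(2) that] by simp
  show "inv\<^bsub>free_Abelian_group S\<^esub> c \<in> Z" if "c \<in> Z" for c
  proof -
    have "Poly_Mapping.keys c \<subseteq> S" using assms(1) that unfolding int_chains_def by force
    then show ?thesis using minus[OF that] by simp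
  qed
  show "c \<otimes>\<^bsub>free_Abelian_group S\<^esub> d \<in> Z" if "c \<in> Z" "d \<in> Z" for c d
    using assms(3)[OF that(1) minus[OF that(2)]] by simp
qed

abbreviation cycle_group where
  "cycle_group B bd r \<equiv> subgroup_generated (free_Abelian_group (B r)) (chain_cycles B bd r)"

lemma subgroup_chain_cycles: "subgroup (chain_cycles B bd r) (free_Abelian_group (B r))"
  by (rule subgroup_chains) (auto simp: chain_cycles_iff frag_extend_diff intro: chains_diff)

lemma carrier_cycle_group: "carrier (cycle_group B bd r) = chain_cycles B bd r"
  using subgroup.carrier_subgroup_generated_subgroup[OF subgroup_chain_cycles] by blast

lemma comm_group_cycle_group: "comm_group (cycle_group B bd r)"
  using group.abelian_subgroup_generated[OF group_free_Abelian_group abelian_free_Abelian_group] .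

lemma chain_boundaries_diff:
  "c \<in> chain_boundaries B bd r \<Longrightarrow> d \<in> chain_boundaries B bd r
    \<Longrightarrow> c - d \<in> chain_boundaries B bd r"
  by (auto simp: chain_boundaries_eq image_iff) (metis chains_diff frag_extend_diff)

lemma chain_boundaries_zero: "0 \<in> chain_boundaries B bd r"
  unfolding chain_boundaries_eq by (rule image_eqI[of _ _ 0]) auto

lemma chain_boundaries_add:
  assumes "c \<in> chain_boundaries B bd r" "d \<in> chain_boundaries B bd r"
  shows "c + d \<in> chain_boundaries B bd r"
  using chain_boundaries_diff[OF assms(1) chain_boundaries_diff[OF chain_boundaries_zero assms(2)]]
  by simp

lemma normal_chain_boundaries:
  assumes "chain_boundaries B bd r \<subseteq> chain_cycles B bd r"
  shows "chain_boundaries B bd r \<lhd> cycle_group B bd r"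
proof (rule comm_group.subgroup_imp_normal[OF comm_group_cycle_group])
  have "subgroup (chain_boundaries B bd r) (free_Abelian_group (B r))"
    using assms
    by (intro subgroup_chains chain_boundaries_diff chain_boundaries_zero)
       (auto simp: chain_cycles_iff)
  then show "subgroup (chain_boundaries B bd r) (cycle_group B bd r)"
    using assms by (simp add: group.subgroup_of_subgroup_generated)
qed

lemma chain_homology_coset:
  "chain_boundaries B bd r #>\<^bsub>cycle_group B bd r\<^esub> c = {b + c | b. b \<in> chain_boundaries B bd r}"
  by (auto simp: r_coset_def)

lemma chain_homology_coset_eq_iff:
  "chain_boundaries B bd r #>\<^bsub>cycle_group B bd r\<^esub> c
     = chain_boundaries B bd r #>\<^bsub>cycle_group B bd r\<^esub> d \<longleftrightarrow> c - d \<in> chain_boundaries B bd r"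
    (is "?C c = ?C d \<longleftrightarrow> ?R")
proof
  assume eq: "?C c = ?C d"
  have "0 + c \<in> ?C c" unfolding chain_homology_coset using chain_boundaries_zero by blast
  then have "c \<in> ?C d" by (simp add: eq)
  then show ?R by (auto simp: chain_homology_coset)
next
  assume R: ?R
  show "?C c = ?C d"
  proof (intro equalityI subsetI)
    fix x assume "x \<in> ?C c"
    then obtain b where "b \<in> chain_boundaries B bd r" "x = b + c"
      by (auto simp: chain_homology_coset)
    then have "x = (b + (c - d)) + d" "b + (c - d) \<in> chain_boundaries B bd r"
      using chain_boundaries_add R by auto
    then show "x \<in> ?C d" unfolding chain_homology_coset by blast
  next
    fix x assume "x \<in> ?C d"
    then obtain b where "b \<in> chain_boundaries B bd r" "x = b + d"
      by (auto simp: chain_homology_coset)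
    then have "x = (b - (c - d)) + c" "b - (c - d) \<in> chain_boundaries B bd r"
      using chain_boundaries_diff R by auto
    then show "x \<in> ?C c" unfolding chain_homology_coset by blast
  qed
qed

text \<open>
  Chain maps that are mutually inverse up to boundaries in one degree are enough for an isomorphism in
  that degree. The first map induces a surjection from the cycles onto the target homology by
  \<open>fg\<close>, whose kernel consists of boundaries by \<open>gf\<close> and \<open>g_bnd\<close>.
\<close>
lemma chain_homology_isoI:
  assumes sub: "chain_boundaries B bd r \<subseteq> chain_cycles B bd r"
    and sub': "chain_boundaries B' bd' r \<subseteq> chain_cycles B' bd' r"
    and f_cyc: "\<And>c. c \<in> chain_cycles B bd r \<Longrightarrow> frag_extend f c \<in> chain_cycles B' bd' r"
    and f_bnd: "\<And>c. c \<in> chain_boundaries B bd r \<Longrightarrow> frag_extend f c \<in> chain_boundaries B' bd' r"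
    and g_cyc: "\<And>c. c \<in> chain_cycles B' bd' r \<Longrightarrow> frag_extend g c \<in> chain_cycles B bd r"
    and g_bnd: "\<And>c. c \<in> chain_boundaries B' bd' r \<Longrightarrow> frag_extend g c \<in> chain_boundaries B bd r"
    and gf: "\<And>c. c \<in> chain_cycles B bd r
               \<Longrightarrow> frag_extend g (frag_extend f c) - c \<in> chain_boundaries B bd r"
    and fg: "\<And>c. c \<in> chain_cycles B' bd' r
               \<Longrightarrow> frag_extend f (frag_extend g c) - c \<in> chain_boundaries B' bd' r"
  shows "chain_homology B bd r \<cong> chain_homology B' bd' r"
proof -
  let ?Z = "cycle_group B bd r" and ?Z' = "cycle_group B' bd' r"
  let ?B = "chain_boundaries B bd r" and ?B' = "chain_boundaries B' bd' r"
  define F where "F c = ?B' #>\<^bsub>?Z'\<^esub> frag_extend f c" for c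
  interpret N: normal ?B' ?Z' using normal_chain_boundaries[OF sub'] .
  interpret Z: comm_group ?Z by (rule comm_group_cycle_group)
  have coset: "F c \<in> carrier (?Z' Mod ?B')" if "c \<in> carrier ?Z" for c
    using f_cyc that unfolding F_def carrier_FactGroup carrier_cycle_group by blast
  have hom: "F \<in> hom ?Z (?Z' Mod ?B')"
  proof (rule homI)
    fix c d assume "c \<in> carrier ?Z" "d \<in> carrier ?Z"
    then show "F (c \<otimes>\<^bsub>?Z\<^esub> d) = F c \<otimes>\<^bsub>?Z' Mod ?B'\<^esub> F d"
      unfolding F_def using f_cyc
      by (simp add: N.rcos_sum carrier_cycle_group frag_extend_add)
  qed (rule coset)
  interpret F: group_hom ?Z "?Z' Mod ?B'" F
    using hom N.factorgroup_is_group Z.is_group by (simp add: group_hom_def group_hom_axioms_def)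
  have "F ` carrier ?Z = carrier (?Z' Mod ?B')"
  proof (intro equalityI subsetI)
    fix X assume "X \<in> carrier (?Z' Mod ?B')"
    then obtain c where c: "c \<in> chain_cycles B' bd' r" "X = ?B' #>\<^bsub>?Z'\<^esub> c"
      by (auto simp: carrier_FactGroup carrier_cycle_group)
    then have "X = F (frag_extend g c)"
      using fg[OF c(1)] by (simp add: F_def chain_homology_coset_eq_iff[symmetric])
    then show "X \<in> F ` carrier ?Z" using g_cyc[OF c(1)] by (simp add: carrier_cycle_group)
  qed (use coset in blast)
  moreover have "kernel ?Z (?Z' Mod ?B') F = ?B"
  proof -
    have ker: "F c = \<one>\<^bsub>?Z' Mod ?B'\<^esub> \<longleftrightarrow> frag_extend f c \<in> ?B'" for c
    proof -
      have "?B' = ?B' #>\<^bsub>?Z'\<^esub> 0" by (simp add: chain_homology_coset)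
      then have "F c = \<one>\<^bsub>?Z' Mod ?B'\<^esub> \<longleftrightarrow> F c = ?B' #>\<^bsub>?Z'\<^esub> 0" by simp
      then show ?thesis unfolding F_def chain_homology_coset_eq_iff by simp
    qed
    have "c \<in> ?B" if c: "c \<in> chain_cycles B bd r" and "frag_extend f c \<in> ?B'" for c
      using chain_boundaries_diff[OF g_bnd[OF that(2)] gf[OF c]] by simp
    then show ?thesis
      unfolding kernel_def ker carrier_cycle_group using sub f_bnd by blast
  qed
  ultimately show ?thesis
    using F.FactGroup_iso_set by (auto simp: chain_homology_def is_iso_def)
qed

section \<open>Free resolutions with a chosen basis\<close>

text \<open>
  Cycles of the complex extended by the augmentation to $\mathbb{Z}$. The augmentation is the map that
  collapses the basis to a point, with $\mathbb{Z}$ written as the chains on a one-element type.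
\<close>
definition augmented_cycle ::
    "(nat \<Rightarrow> 'c \<Rightarrow> 'c \<Rightarrow>\<^sub>0 int) \<Rightarrow> nat \<Rightarrow> ('c \<Rightarrow>\<^sub>0 int) \<Rightarrow> bool" where
  "augmented_cycle bd n c \<longleftrightarrow>
     (if n = 0 then push (\<lambda>_. ()) c = 0 else frag_extend (bd n) c = 0)"

text \<open>
  A $\mathbb{Z}G$-linear map, given by its values on a basis permuted by $G$.
\<close>
definition equivariant_map ::
    "('g, 'b) monoid_scheme \<Rightarrow> 'c set \<Rightarrow> ('g \<Rightarrow> 'c \<Rightarrow> 'c) \<Rightarrow> 'd set \<Rightarrow> ('g \<Rightarrow> 'd \<Rightarrow> 'd)
      \<Rightarrow> ('c \<Rightarrow> 'd \<Rightarrow>\<^sub>0 int) \<Rightarrow> bool" where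
  "equivariant_map G S act S' act' f \<longleftrightarrow>
     (\<forall>x\<in>S. f x \<in> int_chains S' \<and> (\<forall>g\<in>carrier G. f (act g x) = push (act' g) (f x)))"

lemma equivariant_map_frag_extend:
  assumes "equivariant_map G S act S' act' f" "c \<in> int_chains S"
  shows "frag_extend f c \<in> int_chains S'"
    and "g \<in> carrier G \<Longrightarrow> frag_extend f (push (act g) c) = push (act' g) (frag_extend f c)"
proof -
  show "frag_extend f c \<in> int_chains S'"
    using assms by (auto simp: equivariant_map_def intro: chains_frag_extend)
  show "g \<in> carrier G \<Longrightarrow> frag_extend f (push (act g) c) = push (act' g) (frag_extend f c)"
    using assms unfolding frag_extend_push push_frag_extend
    by (intro frag_extend_cong_chains) (auto simp: equivariant_map_def)
qed

lemma equivariant_map_comp: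
  assumes "equivariant_map G S act S' act' f" "equivariant_map G S' act' S'' act'' f'"
  shows "equivariant_map G S act S'' act'' (\<lambda>x. frag_extend f' (f x))"
  using assms(1) equivariant_map_frag_extend[OF assms(2)] unfolding equivariant_map_def by auto

lemma equivariant_map_diff:
  assumes "equivariant_map G S act S' act' f" "equivariant_map G S act S' act' f'"
  shows "equivariant_map G S act S' act' (\<lambda>x. f x - f' x)"
  using assms by (auto simp: equivariant_map_def push_diff intro: chains_diff)

text \<open>
  A resolution of the trivial module $\mathbb{Z}$ by free $\mathbb{Z}G$-modules. The module in degree
  \<open>n\<close> has the $\mathbb{Z}$-basis \<open>S n\<close>, on which \<open>G\<close> acts freely; orbit representatives form a basis
  over $\mathbb{Z}G$. The complex property \<open>bd_cycle\<close> and exactness refer to the augmented complex.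
\<close>
locale free_resolution = group G for G :: "('g, 'b) monoid_scheme" (structure) +
  fixes S :: "nat \<Rightarrow> 'c set"
    and act :: "'g \<Rightarrow> 'c \<Rightarrow> 'c"
    and bd :: "nat \<Rightarrow> 'c \<Rightarrow> 'c \<Rightarrow>\<^sub>0 int"
  assumes act_closed: "\<lbrakk>g \<in> carrier G; x \<in> S n\<rbrakk> \<Longrightarrow> act g x \<in> S n"
    and act_one: "x \<in> S n \<Longrightarrow> act \<one> x = x"
    and act_mult: "\<lbrakk>g \<in> carrier G; h \<in> carrier G; x \<in> S n\<rbrakk> \<Longrightarrow> act (g \<otimes> h) x = act g (act h x)"
    and act_free: "\<lbrakk>g \<in> carrier G; x \<in> S n; act g x = x\<rbrakk> \<Longrightarrow> g = \<one>"
    and basis_0_nonempty: "S 0 \<noteq> {}"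
    and bd_zero: "x \<in> S 0 \<Longrightarrow> bd 0 x = 0"
    and bd_closed: "x \<in> S (Suc n) \<Longrightarrow> bd (Suc n) x \<in> int_chains (S n)"
    and bd_act: "\<lbrakk>g \<in> carrier G; x \<in> S (Suc n)\<rbrakk>
                  \<Longrightarrow> bd (Suc n) (act g x) = push (act g) (bd (Suc n) x)"
    and bd_cycle: "x \<in> S (Suc n) \<Longrightarrow> augmented_cycle bd n (bd (Suc n) x)"
    and exact: "\<lbrakk>c \<in> int_chains (S n); augmented_cycle bd n c\<rbrakk>
                  \<Longrightarrow> \<exists>b\<in>int_chains (S (Suc n)). frag_extend (bd (Suc n)) b = c"
begin

lemma push_act_closed: "g \<in> carrier G \<Longrightarrow> c \<in> int_chains (S n) \<Longrightarrow> push (act g) c \<in> int_chains (S n)"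
  using act_closed by (auto intro: chains_push)

lemma push_act_mult:
  "\<lbrakk>g \<in> carrier G; h \<in> carrier G; c \<in> int_chains (S n)\<rbrakk>
    \<Longrightarrow> push (act (g \<otimes> h)) c = push (act g) (push (act h) c)"
  unfolding push_push using act_mult by (auto intro: push_cong_chains)

lemma equivariant_bd: "equivariant_map G (S (Suc n)) act (S n) act (bd (Suc n))"
  using bd_closed bd_act by (auto simp: equivariant_map_def)

lemma equivariant_ident: "equivariant_map G (S n) act (S n) act frag_of"
  by (simp add: equivariant_map_def)

lemmas bd_chains_closed = equivariant_map_frag_extend(1)[OF equivariant_bd]
lemmas bd_chains_act = equivariant_map_frag_extend(2)[OF equivariant_bd]

lemma augmented_cycle_bd:
  assumes "c \<in> int_chains (S (Suc n))"
  shows "augmented_cycle bd n (frag_extend (bd (Suc n)) c)"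
  using bd_cycle[of _ n]
  by (auto simp: augmented_cycle_def push_frag_extend frag_extend_frag_extend
      intro: frag_extend_zero_chains[OF assms])

lemma bd_bd: "c \<in> int_chains (S (Suc n)) \<Longrightarrow> frag_extend (bd n) (frag_extend (bd (Suc n)) c) = 0"
proof (cases n)
  case 0
  assume "c \<in> int_chains (S (Suc n))"
  then have "frag_extend (bd (Suc n)) c \<in> int_chains (S 0)"
    using bd_chains_closed 0 by blast
  then show ?thesis
    using frag_extend_zero_chains bd_zero 0 by blast
next
  case (Suc m)
  assume "c \<in> int_chains (S (Suc n))"
  then show ?thesis using augmented_cycle_bd[of c n] Suc by (simp add: augmented_cycle_def)
qed

end

text \<open>
  This is freeness over $\mathbb{Z}G$. Pointwise choices are made at one representative of each orbit
  and transported along the orbit, which is unambiguous because a point of a free orbit is reached from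
  the representative by exactly one group element.
\<close>
lemma equivariant_choice:
  assumes "free_resolution G S act bd" "free_resolution G S' act' bd'"
    and ex: "\<And>x. x \<in> S n \<Longrightarrow> \<exists>y\<in>int_chains (S' m). P x y"
    and inv: "\<And>g x y. \<lbrakk>g \<in> carrier G; x \<in> S n; y \<in> int_chains (S' m); P x y\<rbrakk>
                \<Longrightarrow> P (act g x) (push (act' g) y)"
  shows "\<exists>f. equivariant_map G (S n) act (S' m) act' f \<and> (\<forall>x\<in>S n. P x (f x))"
proof -
  interpret X: free_resolution G S act bd by fact
  interpret Y: free_resolution G S' act' bd' by fact
  \<comment> \<open>\<open>rep\<close> is constant on orbits, and \<open>el x\<close> carries \<open>rep x\<close> to \<open>x\<close>\<close>
  define orb where "orb x = {act g x | g. g \<in> carrier G}" for x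
  define rep where "rep x = (SOME y. y \<in> orb x)" for x
  define el where "el x = (THE g. g \<in> carrier G \<and> act g (rep x) = x)" for x
  define pick where "pick x = (SOME y. y \<in> int_chains (S' m) \<and> P x y)" for x
  define f where "f x = push (act' (el x)) (pick (rep x))" for x
  have orb_act: "orb (act g x) = orb x" if "g \<in> carrier G" "x \<in> S n" for g x
  proof (intro equalityI subsetI)
    fix y assume "y \<in> orb (act g x)"
    then obtain h where "h \<in> carrier G" "y = act h (act g x)" by (auto simp: orb_def)
    then have "y = act (h \<otimes>\<^bsub>G\<^esub> g) x" "h \<otimes>\<^bsub>G\<^esub> g \<in> carrier G" using X.act_mult that by auto
    then show "y \<in> orb x" by (auto simp: orb_def)
  next
    fix y assume "y \<in> orb x"
    then obtain h where h: "h \<in> carrier G" "y = act h x" by (auto simp: orb_def)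
    let ?k = "h \<otimes>\<^bsub>G\<^esub> inv\<^bsub>G\<^esub> g"
    have k: "?k \<in> carrier G" using h that by simp
    have "act ?k (act g x) = act (?k \<otimes>\<^bsub>G\<^esub> g) x"
      using X.act_mult[OF k that] by simp
    also have "?k \<otimes>\<^bsub>G\<^esub> g = h" using h that by (simp add: X.m_assoc)
    finally show "y \<in> orb (act g x)" using h k unfolding orb_def by force
  qed
  have rep_mem: "rep x \<in> orb x" if "x \<in> S n" for x
  proof -
    have "x \<in> orb x" using X.act_one[OF that] unfolding orb_def by force
    then show ?thesis unfolding rep_def by (rule someI)
  qed
  have rep_S: "rep x \<in> S n" if "x \<in> S n" for x
    using rep_mem[OF that] X.act_closed that by (auto simp: orb_def)
  have rep_act: "rep (act g x) = rep x" if "g \<in> carrier G" "x \<in> S n" for g x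
    using orb_act[OF that] by (simp add: rep_def)
  have uniq: "g = h" if "g \<in> carrier G" "h \<in> carrier G" "x \<in> S n" "act g x = act h x" for g h x
  proof -
    have "act (inv\<^bsub>G\<^esub> h \<otimes>\<^bsub>G\<^esub> g) x = act (inv\<^bsub>G\<^esub> h \<otimes>\<^bsub>G\<^esub> h) x"
      using that by (simp only: X.act_mult X.inv_closed)
    then have "inv\<^bsub>G\<^esub> h \<otimes>\<^bsub>G\<^esub> g = \<one>\<^bsub>G\<^esub>"
      using that X.act_one X.act_free[of "inv\<^bsub>G\<^esub> h \<otimes>\<^bsub>G\<^esub> g" x] by simp
    then show ?thesis
      using that by (metis X.inv_closed X.inv_equality X.inv_inv)
  qed
  have el: "el x \<in> carrier G \<and> act (el x) (rep x) = x" if x: "x \<in> S n" for x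
  proof -
    obtain h where h: "h \<in> carrier G" "rep x = act h x" using rep_mem[OF x] by (auto simp: orb_def)
    then have "act (inv\<^bsub>G\<^esub> h) (rep x) = act (inv\<^bsub>G\<^esub> h \<otimes>\<^bsub>G\<^esub> h) x"
      using x by (simp only: X.act_mult X.inv_closed)
    then have "act (inv\<^bsub>G\<^esub> h) (rep x) = x" using h x by (simp only: X.act_one X.l_inv)
    then have "\<exists>!g. g \<in> carrier G \<and> act g (rep x) = x"
      using h uniq rep_S[OF x] by (intro ex1I[of _ "inv\<^bsub>G\<^esub> h"]) (auto intro: uniq)
    then show ?thesis unfolding el_def by (rule theI')
  qed
  have el_act: "el (act g x) = g \<otimes>\<^bsub>G\<^esub> el x" if g: "g \<in> carrier G" and x: "x \<in> S n" for g x
  proof (rule uniq[OF _ _ rep_S[OF x]])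
    show "el (act g x) \<in> carrier G" "g \<otimes>\<^bsub>G\<^esub> el x \<in> carrier G"
      using el X.act_closed g x by auto
    have "act (el (act g x)) (rep x) = act g x"
      using el[OF X.act_closed[OF g x]] rep_act[OF g x] by simp
    also have "\<dots> = act (g \<otimes>\<^bsub>G\<^esub> el x) (rep x)"
      using X.act_mult[OF g _ rep_S[OF x]] el[OF x] by simp
    finally show "act (el (act g x)) (rep x) = act (g \<otimes>\<^bsub>G\<^esub> el x) (rep x)" .
  qed
  have pick: "pick x \<in> int_chains (S' m) \<and> P x (pick x)" if "x \<in> S n" for x
    unfolding pick_def by (rule someI_ex) (use ex[OF that] in blast)
  have f_closed: "f x \<in> int_chains (S' m)" if x: "x \<in> S n" for x
    unfolding f_def using el[OF x] pick[OF rep_S[OF x]] by (intro Y.push_act_closed) auto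
  have f_P: "P x (f x)" if x: "x \<in> S n" for x
  proof -
    have "P (act (el x) (rep x)) (f x)"
      unfolding f_def using el[OF x] pick[OF rep_S[OF x]] rep_S[OF x] by (intro inv) auto
    then show ?thesis using el[OF x] by simp
  qed
  have "f (act g x) = push (act' g) (f x)" if g: "g \<in> carrier G" and x: "x \<in> S n" for g x
    unfolding f_def el_act[OF g x] rep_act[OF g x]
    using g el[OF x] pick[OF rep_S[OF x]] by (intro Y.push_act_mult) auto
  then show ?thesis using f_closed f_P unfolding equivariant_map_def by blast
qed

text \<open>
  The chain map over the identity of $\mathbb{Z}$ is built by recursion on the degree. It is part of the
  induction hypothesis that augmented cycles go to augmented cycles: this makes the image of a boundary
  a cycle of the exact target complex, hence a boundary, and a preimage of it is the next value.
\<close>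
lemma ex_equivariant_chain_map:
  assumes X: "free_resolution G S act bd" and Y: "free_resolution G S' act' bd'"
  shows "\<exists>f. (\<forall>n. equivariant_map G (S n) act (S' n) act' (f n))
           \<and> (\<forall>x\<in>S 0. push (\<lambda>_. ()) (f 0 x) = frag_of ())
           \<and> (\<forall>n. \<forall>x\<in>S (Suc n). frag_extend (bd' (Suc n)) (f (Suc n) x)
                                   = frag_extend (f n) (bd (Suc n) x))"
proof -
  interpret X: free_resolution G S act bd by fact
  interpret Y: free_resolution G S' act' bd' by fact
  define P where "P n f \<longleftrightarrow> equivariant_map G (S n) act (S' n) act' f
      \<and> (n = 0 \<longrightarrow> (\<forall>x\<in>S 0. push (\<lambda>_. ()) (f x) = frag_of ()))
      \<and> (\<forall>c\<in>int_chains (S n). augmented_cycle bd n c \<longrightarrow> augmented_cycle bd' n (frag_extend f c))" for n f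
  define Q where "Q n f f' \<longleftrightarrow> (\<forall>x\<in>S (Suc n). frag_extend (bd' (Suc n)) (f' x)
                                                 = frag_extend f (bd (Suc n) x))" for n f f'
  have "\<exists>f. \<forall>n. P n (f n) \<and> Q n (f n) (f (Suc n))"
  proof (rule dependent_nat_choice)
    \<comment> \<open>any basis element of the target has augmentation 1\<close>
    obtain y where y: "y \<in> S' 0" using Y.basis_0_nonempty by blast
    have "\<exists>f. equivariant_map G (S 0) act (S' 0) act' f \<and> (\<forall>x\<in>S 0. push (\<lambda>_. ()) (f x) = frag_of ())"
    proof (rule equivariant_choice[OF X Y])
      show "\<exists>c\<in>int_chains (S' 0). push (\<lambda>_. ()) c = frag_of ()"
        using y by (intro bexI[of _ "frag_of y"]) auto
    qed (simp add: push_push)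
    then obtain f where f: "equivariant_map G (S 0) act (S' 0) act' f"
      "\<And>x. x \<in> S 0 \<Longrightarrow> push (\<lambda>_. ()) (f x) = frag_of ()" by blast
    have "push (\<lambda>_. ()) (frag_extend f c) = push (\<lambda>_. ()) c" if "c \<in> int_chains (S 0)" for c
      unfolding push_frag_extend using f(2)
      by (subst push_def, intro frag_extend_cong_chains[OF that]) simp
    then show "\<exists>f. P 0 f" using f by (auto simp: P_def augmented_cycle_def)
  next
    fix f n assume P: "P n f"
    have "\<exists>f'. equivariant_map G (S (Suc n)) act (S' (Suc n)) act' f' \<and> Q n f f'"
      unfolding Q_def
    proof (rule equivariant_choice[OF X Y])
      fix x assume "x \<in> S (Suc n)"
      then show "\<exists>y\<in>int_chains (S' (Suc n)). frag_extend (bd' (Suc n)) y = frag_extend f (bd (Suc n) x)"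
        using P X.bd_closed X.bd_cycle equivariant_map_frag_extend(1)
        by (intro Y.exact) (fastforce simp: P_def)+
    next
      fix g x y assume *: "g \<in> carrier G" "x \<in> S (Suc n)" "y \<in> int_chains (S' (Suc n))"
        "frag_extend (bd' (Suc n)) y = frag_extend f (bd (Suc n) x)"
      moreover have "frag_extend f (push (act g) (bd (Suc n) x)) = push (act' g) (frag_extend f (bd (Suc n) x))"
        using P equivariant_map_frag_extend(2)[OF _ X.bd_closed[OF *(2)] *(1)] unfolding P_def by blast
      ultimately show "frag_extend (bd' (Suc n)) (push (act' g) y) = frag_extend f (bd (Suc n) (act g x))"
        by (simp add: Y.bd_chains_act X.bd_act)
    qed
    then obtain f' where f': "equivariant_map G (S (Suc n)) act (S' (Suc n)) act' f'" "Q n f f'"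
      by blast
    moreover have "augmented_cycle bd' (Suc n) (frag_extend f' c)"
      if c: "c \<in> int_chains (S (Suc n))" "augmented_cycle bd (Suc n) c" for c
    proof -
      have "frag_extend (bd' (Suc n)) (frag_extend f' c) = frag_extend f (frag_extend (bd (Suc n)) c)"
        unfolding frag_extend_frag_extend
        by (rule frag_extend_cong_chains[OF c(1)]) (use f'(2) in \<open>simp add: Q_def\<close>)
      then show ?thesis using c(2) by (simp add: augmented_cycle_def)
    qed
    ultimately show "\<exists>f'. P (Suc n) f' \<and> Q n f f'" by (auto simp: P_def)
  qed
  then obtain f where "\<forall>n. P n (f n) \<and> Q n (f n) (f (Suc n))" by blast
  then show ?thesis unfolding P_def Q_def by blast
qed

text \<open>
  If $h_0, \ldots, h_n$ are constructed, then $\phi_{n+1} - h_n \partial$ takes values in cycles, because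
  $\partial h_n = \phi_n$ on cycles, and exactness of the target supplies $h_{n+1}$. In degree $0$ the
  values of $\phi_0$ are cycles because the augmentation kills them.
\<close>
lemma ex_equivariant_null_homotopy:
  assumes X: "free_resolution G S act bd" and Y: "free_resolution G S' act' bd'"
    and eq: "\<And>n. equivariant_map G (S n) act (S' n) act' (\<phi> n)"
    and chain_map: "\<And>n x. x \<in> S (Suc n)
                      \<Longrightarrow> frag_extend (bd' (Suc n)) (\<phi> (Suc n) x) = frag_extend (\<phi> n) (bd (Suc n) x)"
    and aug: "\<And>x. x \<in> S 0 \<Longrightarrow> push (\<lambda>_. ()) (\<phi> 0 x) = 0"
  shows "\<exists>h. (\<forall>n. equivariant_map G (S n) act (S' (Suc n)) act' (h n))
           \<and> (\<forall>x\<in>S 0. frag_extend (bd' (Suc 0)) (h 0 x) = \<phi> 0 x)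
           \<and> (\<forall>n. \<forall>x\<in>S (Suc n). frag_extend (bd' (Suc (Suc n))) (h (Suc n) x)
                 = \<phi> (Suc n) x - frag_extend (h n) (bd (Suc n) x))"
proof -
  interpret X: free_resolution G S act bd by fact
  interpret Y: free_resolution G S' act' bd' by fact
  define P where "P n h \<longleftrightarrow> equivariant_map G (S n) act (S' (Suc n)) act' h
      \<and> (n = 0 \<longrightarrow> (\<forall>x\<in>S 0. frag_extend (bd' (Suc 0)) (h x) = \<phi> 0 x))
      \<and> (\<forall>c\<in>int_chains (S n). augmented_cycle bd n c
            \<longrightarrow> frag_extend (bd' (Suc n)) (frag_extend h c) = frag_extend (\<phi> n) c)" for n h
  define Q where "Q n h h' \<longleftrightarrow> (\<forall>x\<in>S (Suc n). frag_extend (bd' (Suc (Suc n))) (h' x)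
                 = \<phi> (Suc n) x - frag_extend h (bd (Suc n) x))" for n h h'
  have "\<exists>h. \<forall>n. P n (h n) \<and> Q n (h n) (h (Suc n))"
  proof (rule dependent_nat_choice)
    have "\<exists>h. equivariant_map G (S 0) act (S' (Suc 0)) act' h
            \<and> (\<forall>x\<in>S 0. frag_extend (bd' (Suc 0)) (h x) = \<phi> 0 x)"
    proof (rule equivariant_choice[OF X Y])
      fix x assume "x \<in> S 0"
      then show "\<exists>y\<in>int_chains (S' (Suc 0)). frag_extend (bd' (Suc 0)) y = \<phi> 0 x"
        using eq[of 0] aug by (intro Y.exact) (auto simp: equivariant_map_def augmented_cycle_def)
    next
      fix g x y assume "g \<in> carrier G" "x \<in> S 0" "y \<in> int_chains (S' (Suc 0))"
        "frag_extend (bd' (Suc 0)) y = \<phi> 0 x"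
      then show "frag_extend (bd' (Suc 0)) (push (act' g) y) = \<phi> 0 (act g x)"
        using eq[of 0] by (simp add: Y.bd_chains_act equivariant_map_def)
    qed
    then obtain h where h: "equivariant_map G (S 0) act (S' (Suc 0)) act' h"
      "\<forall>x\<in>S 0. frag_extend (bd' (Suc 0)) (h x) = \<phi> 0 x" by blast
    moreover have "frag_extend (bd' (Suc 0)) (frag_extend h c) = frag_extend (\<phi> 0) c"
      if "c \<in> int_chains (S 0)" for c
      unfolding frag_extend_frag_extend using h(2) by (intro frag_extend_cong_chains[OF that]) simp
    ultimately show "\<exists>h. P 0 h" by (auto simp: P_def)
  next
    fix h n assume P: "P n h"
    then have h: "equivariant_map G (S n) act (S' (Suc n)) act' h"
      and bd_h: "\<And>c. c \<in> int_chains (S n) \<Longrightarrow> augmented_cycle bd n c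
                  \<Longrightarrow> frag_extend (bd' (Suc n)) (frag_extend h c) = frag_extend (\<phi> n) c"
      by (auto simp: P_def)
    have "\<exists>h'. equivariant_map G (S (Suc n)) act (S' (Suc (Suc n))) act' h' \<and> Q n h h'"
      unfolding Q_def
    proof (rule equivariant_choice[OF X Y])
      fix x assume x: "x \<in> S (Suc n)"
      show "\<exists>y\<in>int_chains (S' (Suc (Suc n))). frag_extend (bd' (Suc (Suc n))) y
              = \<phi> (Suc n) x - frag_extend h (bd (Suc n) x)"
      proof (rule Y.exact)
        show "\<phi> (Suc n) x - frag_extend h (bd (Suc n) x) \<in> int_chains (S' (Suc n))"
          using eq[of "Suc n"] equivariant_map_frag_extend(1)[OF h] X.bd_closed x
          by (auto simp: equivariant_map_def intro: chains_diff)
        show "augmented_cycle bd' (Suc n) (\<phi> (Suc n) x - frag_extend h (bd (Suc n) x))"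
          using chain_map[OF x] bd_h[OF X.bd_closed[OF x] X.bd_cycle[OF x]]
          by (simp add: augmented_cycle_def frag_extend_diff)
      qed
    next
      fix g x y assume "g \<in> carrier G" "x \<in> S (Suc n)" "y \<in> int_chains (S' (Suc (Suc n)))"
        "frag_extend (bd' (Suc (Suc n))) y = \<phi> (Suc n) x - frag_extend h (bd (Suc n) x)"
      then show "frag_extend (bd' (Suc (Suc n))) (push (act' g) y)
                   = \<phi> (Suc n) (act g x) - frag_extend h (bd (Suc n) (act g x))"
        using eq[of "Suc n"] equivariant_map_frag_extend(2)[OF h]
        by (simp add: Y.bd_chains_act X.bd_act X.bd_closed equivariant_map_def push_diff)
    qed
    then obtain h' where h': "equivariant_map G (S (Suc n)) act (S' (Suc (Suc n))) act' h'" "Q n h h'"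
      by blast
    moreover have "frag_extend (bd' (Suc (Suc n))) (frag_extend h' c) = frag_extend (\<phi> (Suc n)) c"
      if c: "c \<in> int_chains (S (Suc n))" "augmented_cycle bd (Suc n) c" for c
    proof -
      have "frag_extend (bd' (Suc (Suc n))) (frag_extend h' c)
          = frag_extend (\<lambda>x. \<phi> (Suc n) x - frag_extend h (bd (Suc n) x)) c"
        unfolding frag_extend_frag_extend
        using h'(2) by (intro frag_extend_cong_chains[OF c(1)]) (simp add: Q_def)
      also have "\<dots> = frag_extend (\<phi> (Suc n)) c - frag_extend h (frag_extend (bd (Suc n)) c)"
        by (simp add: frag_extend_fun_diff frag_extend_frag_extend)
      finally show ?thesis using c(2) by (simp add: augmented_cycle_def)
    qed
    ultimately show "\<exists>h'. P (Suc n) h' \<and> Q n h h'" by (auto simp: P_def)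
  qed
  then obtain h where "\<forall>n. P n (h n) \<and> Q n (h n) (h (Suc n))" by blast
  then show ?thesis unfolding P_def Q_def by blast
qed

section \<open>Coinvariants\<close>

text \<open>
  The map \<open>\<pi>\<close> identifies \<open>T n\<close> with the set of orbits in \<open>S n\<close>, so that the chains on \<open>T n\<close> are the
  module of coinvariants in degree \<open>n\<close>.
\<close>
locale free_resolution_coinvariants = free_resolution G S act bd
  for G :: "('g, 'b) monoid_scheme" (structure) and S :: "nat \<Rightarrow> 'c set" and act bd +
  fixes T :: "nat \<Rightarrow> 't set" and \<pi> :: "'c \<Rightarrow> 't" and bdT :: "nat \<Rightarrow> 't \<Rightarrow> 't \<Rightarrow>\<^sub>0 int"
  assumes proj_image: "\<pi> ` S n = T n"
    and proj_act: "\<lbrakk>g \<in> carrier G; x \<in> S n\<rbrakk> \<Longrightarrow> \<pi> (act g x) = \<pi> x"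
    and proj_eq: "\<lbrakk>x \<in> S n; y \<in> S n; \<pi> x = \<pi> y\<rbrakk> \<Longrightarrow> \<exists>g\<in>carrier G. y = act g x"
    and proj_bd: "x \<in> S n \<Longrightarrow> bdT n (\<pi> x) = push \<pi> (bd n x)"
begin

lemma proj_bd_chains:
  "c \<in> int_chains (S n) \<Longrightarrow> frag_extend (bdT n) (push \<pi> c) = push \<pi> (frag_extend (bd n) c)"
  unfolding frag_extend_push push_frag_extend
  by (rule frag_extend_cong_chains) (auto simp: proj_bd)

lemma push_proj_closed: "c \<in> int_chains (S n) \<Longrightarrow> push \<pi> c \<in> int_chains (T n)"
  by (erule chains_push) (use proj_image in blast)

lemma boundaries_subset_cycles: "chain_boundaries T bdT r \<subseteq> chain_cycles T bdT r"
proof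
  fix b assume "b \<in> chain_boundaries T bdT r"
  then obtain t where "t \<in> int_chains (T (Suc r))" and b: "b = frag_extend (bdT (Suc r)) t"
    by (auto simp: chain_boundaries_eq)
  then obtain c where c: "c \<in> int_chains (S (Suc r))" "t = push \<pi> c"
    using chains_image_push[OF proj_image] by blast
  then show "b \<in> chain_cycles T bdT r"
    using b by (simp add: chain_cycles_iff proj_bd_chains bd_chains_closed push_proj_closed bd_bd)
qed

text \<open>
  The image of \<open>f x\<close> in the coinvariants of the target depends only on the orbit of \<open>x\<close>, since
  translating \<open>x\<close> translates \<open>f x\<close>.
\<close>
lemma ex_coinvariant_map:
  assumes "equivariant_map G (S n) act S' act' f"
    and "\<And>g y. g \<in> carrier G \<Longrightarrow> y \<in> S' \<Longrightarrow> \<pi>' (act' g y) = \<pi>' y"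
  shows "\<exists>f'. \<forall>c\<in>int_chains (S n). frag_extend f' (push \<pi> c) = push \<pi>' (frag_extend f c)"
proof
  define rep where "rep t = (SOME x. x \<in> S n \<and> \<pi> x = t)" for t
  let ?f' = "\<lambda>t. push \<pi>' (f (rep t))"
  have "?f' (\<pi> x) = push \<pi>' (f x)" if x: "x \<in> S n" for x
  proof -
    have r: "rep (\<pi> x) \<in> S n \<and> \<pi> (rep (\<pi> x)) = \<pi> x"
      unfolding rep_def by (rule someI_ex) (use x in auto)
    then obtain g where g: "g \<in> carrier G" "rep (\<pi> x) = act g x"
      using proj_eq[OF x] by metis
    then have "?f' (\<pi> x) = push (\<lambda>y. \<pi>' (act' g y)) (f x)"
      using assms(1) x by (simp add: equivariant_map_def push_push)
    also have "\<dots> = push \<pi>' (f x)"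
      using assms x g by (intro push_cong_chains[of _ S']) (auto simp: equivariant_map_def)
    finally show ?thesis .
  qed
  then show "\<forall>c\<in>int_chains (S n). frag_extend ?f' (push \<pi> c) = push \<pi>' (frag_extend f c)"
    unfolding frag_extend_push push_frag_extend by (auto intro: frag_extend_cong_chains)
qed

end

lemma ex_coinvariant_chain_map:
  assumes X: "free_resolution_coinvariants G S act bd T \<pi> bdT"
    and Y: "free_resolution_coinvariants G S' act' bd' T' \<pi>' bdT'"
    and eq: "\<And>n. equivariant_map G (S n) act (S' n) act' (f n)"
    and chain_map: "\<And>n x. x \<in> S (Suc n)
                      \<Longrightarrow> frag_extend (bd' (Suc n)) (f (Suc n) x) = frag_extend (f n) (bd (Suc n) x)"
  obtains f' where
    "\<And>n c. c \<in> int_chains (S n) \<Longrightarrow> frag_extend (f' n) (push \<pi> c) = push \<pi>' (frag_extend (f n) c)"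
    "\<And>n c. c \<in> chain_cycles T bdT n \<Longrightarrow> frag_extend (f' n) c \<in> chain_cycles T' bdT' n"
    "\<And>n c. c \<in> chain_boundaries T bdT n \<Longrightarrow> frag_extend (f' n) c \<in> chain_boundaries T' bdT' n"
proof -
  interpret X: free_resolution_coinvariants G S act bd T \<pi> bdT by fact
  interpret Y: free_resolution_coinvariants G S' act' bd' T' \<pi>' bdT' by fact
  have "\<exists>f'. \<forall>n. \<forall>c\<in>int_chains (S n). frag_extend (f' n) (push \<pi> c) = push \<pi>' (frag_extend (f n) c)"
  proof (rule choice, rule allI)
    fix n
    show "\<exists>f'. \<forall>c\<in>int_chains (S n). frag_extend f' (push \<pi> c) = push \<pi>' (frag_extend (f n) c)"
      by (rule X.ex_coinvariant_map[where \<pi>' = \<pi>', OF eq]) (rule Y.proj_act)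
  qed
  then obtain f' where f': "\<And>n c. c \<in> int_chains (S n)
      \<Longrightarrow> frag_extend (f' n) (push \<pi> c) = push \<pi>' (frag_extend (f n) c)"
    by blast
  have closed: "frag_extend (f n) c \<in> int_chains (S' n)" if "c \<in> int_chains (S n)" for n c
    by (rule equivariant_map_frag_extend(1)[OF eq that])
  have bd_f: "frag_extend (bd' (Suc n)) (frag_extend (f (Suc n)) c)
                = frag_extend (f n) (frag_extend (bd (Suc n)) c)" if "c \<in> int_chains (S (Suc n))" for n c
    unfolding frag_extend_frag_extend by (rule frag_extend_cong_chains[OF that chain_map])
  have bdT_f': "frag_extend (bdT' (Suc n)) (frag_extend (f' (Suc n)) c)
                = frag_extend (f' n) (frag_extend (bdT (Suc n)) c)"
    and closed': "frag_extend (f' (Suc n)) c \<in> int_chains (T' (Suc n))"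
    if c_chain: "c \<in> int_chains (T (Suc n))" for n c
  proof -
    obtain d where d: "d \<in> int_chains (S (Suc n))" and c: "c = push \<pi> d"
      using chains_image_push[OF X.proj_image c_chain] by blast
    show "frag_extend (bdT' (Suc n)) (frag_extend (f' (Suc n)) c)
                = frag_extend (f' n) (frag_extend (bdT (Suc n)) c)"
      "frag_extend (f' (Suc n)) c \<in> int_chains (T' (Suc n))"
      unfolding c using d
      by (simp_all add: f' bd_f closed X.proj_bd_chains Y.proj_bd_chains X.bd_chains_closed
          Y.push_proj_closed)
  qed
  show ?thesis
  proof (rule that[OF f'])
    fix n c assume c: "c \<in> chain_cycles T bdT n"
    then obtain d where d: "d \<in> int_chains (S n)" "c = push \<pi> d"
      using chains_image_push[OF X.proj_image] unfolding chain_cycles_iff by blast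
    have "frag_extend (bdT' n) (frag_extend (f' n) c) = 0"
    proof (cases n)
      case 0
      have "bd' 0 y = 0" if "y \<in> S' 0" for y using Y.bd_zero that .
      then have "frag_extend (bd' n) (frag_extend (f n) d) = frag_extend (\<lambda>_. 0) (frag_extend (f n) d)"
        using closed[OF d(1)] 0 by (intro frag_extend_cong_chains) auto
      then show ?thesis
        using d(1) 0 unfolding d(2) by (simp add: f' closed Y.proj_bd_chains frag_extend_eq_0)
    next
      case (Suc m)
      then show ?thesis using bdT_f' c by (simp add: chain_cycles_iff)
    qed
    then show "frag_extend (f' n) c \<in> chain_cycles T' bdT' n"
      using d(1) unfolding d(2) by (simp add: chain_cycles_iff f' closed Y.push_proj_closed)
  next
    fix n c assume "c \<in> chain_boundaries T bdT n"
    then obtain b where "b \<in> int_chains (T (Suc n))" "c = frag_extend (bdT (Suc n)) b"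
      by (auto simp: chain_boundaries_eq)
    then show "frag_extend (f' n) c \<in> chain_boundaries T' bdT' n"
      using bdT_f' closed' by (auto simp: chain_boundaries_eq image_iff intro!: bexI[of _ "frag_extend (f' (Suc n)) b"])
  qed
qed

text \<open>
  The composite of two equivariant chain maps over the identity of $\mathbb{Z}$ is homotopic to the
  identity by an equivariant homotopy, which descends to the coinvariants. A cycle downstairs need not be the image of a cycle, so
  the homotopy formula is evaluated on a lift \<open>c\<close> and its second term disappears only after projecting.
\<close>
lemma coinvariant_round_trip:
  assumes X: "free_resolution_coinvariants G S act bd T \<pi> bdT"
    and f_eq: "\<And>n. equivariant_map G (S n) act (S' n) act' (f n)"
    and f_map: "\<And>n x. x \<in> S (Suc n)
                  \<Longrightarrow> frag_extend (bd' (Suc n)) (f (Suc n) x) = frag_extend (f n) (bd (Suc n) x)"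
    and f_aug: "\<And>x. x \<in> S 0 \<Longrightarrow> push (\<lambda>_. ()) (f 0 x) = frag_of ()"
    and f'_eq: "\<And>n. equivariant_map G (S' n) act' (S n) act (f' n)"
    and f'_map: "\<And>n x. x \<in> S' (Suc n)
                  \<Longrightarrow> frag_extend (bd (Suc n)) (f' (Suc n) x) = frag_extend (f' n) (bd' (Suc n) x)"
    and f'_aug: "\<And>x. x \<in> S' 0 \<Longrightarrow> push (\<lambda>_. ()) (f' 0 x) = frag_of ()"
    and c: "c \<in> int_chains (S n)" "push \<pi> c \<in> chain_cycles T bdT n"
  shows "push \<pi> (frag_extend (f' n) (frag_extend (f n) c)) - push \<pi> c \<in> chain_boundaries T bdT n"
proof -
  interpret X: free_resolution_coinvariants G S act bd T \<pi> bdT by fact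
  define \<phi> where "\<phi> n x = frag_extend (f' n) (f n x) - frag_of x" for n x
  have "\<exists>h. (\<forall>n. equivariant_map G (S n) act (S (Suc n)) act (h n))
           \<and> (\<forall>x\<in>S 0. frag_extend (bd (Suc 0)) (h 0 x) = \<phi> 0 x)
           \<and> (\<forall>n. \<forall>x\<in>S (Suc n). frag_extend (bd (Suc (Suc n))) (h (Suc n) x)
                 = \<phi> (Suc n) x - frag_extend (h n) (bd (Suc n) x))"
  proof (rule ex_equivariant_null_homotopy)
    show "equivariant_map G (S n) act (S n) act (\<phi> n)" for n
      unfolding \<phi>_def
      by (rule equivariant_map_diff[OF equivariant_map_comp[OF f_eq f'_eq] X.equivariant_ident])
    show "frag_extend (bd (Suc n)) (\<phi> (Suc n) x) = frag_extend (\<phi> n) (bd (Suc n) x)"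
      if x: "x \<in> S (Suc n)" for n x
    proof -
      have "f (Suc n) x \<in> int_chains (S' (Suc n))" using f_eq x by (auto simp: equivariant_map_def)
      then have "frag_extend (bd (Suc n)) (frag_extend (f' (Suc n)) (f (Suc n) x))
          = frag_extend (f' n) (frag_extend (bd' (Suc n)) (f (Suc n) x))"
        unfolding frag_extend_frag_extend by (rule frag_extend_cong_chains[OF _ f'_map])
      also have "\<dots> = frag_extend (\<lambda>x. frag_extend (f' n) (f n x)) (bd (Suc n) x)"
        by (simp add: f_map[OF x] frag_extend_frag_extend)
      finally show ?thesis by (simp add: \<phi>_def[abs_def] frag_extend_diff frag_extend_fun_diff)
    qed
    show "push (\<lambda>_. ()) (\<phi> 0 x) = 0" if x: "x \<in> S 0" for x
    proof -
      have "f 0 x \<in> int_chains (S' 0)" using f_eq x by (auto simp: equivariant_map_def)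
      then have "push (\<lambda>_. ()) (frag_extend (f' 0) (f 0 x)) = push (\<lambda>_. ()) (f 0 x)"
        unfolding push_frag_extend
        by (subst (2) push_def) (auto intro: frag_extend_cong_chains simp: f'_aug)
      then show ?thesis by (simp add: \<phi>_def push_diff f_aug[OF x])
    qed
  qed (fact X.free_resolution_axioms)+
  then obtain h where h: "\<And>n. equivariant_map G (S n) act (S (Suc n)) act (h n)"
      "\<And>x. x \<in> S 0 \<Longrightarrow> frag_extend (bd (Suc 0)) (h 0 x) = \<phi> 0 x"
      "\<And>n x. x \<in> S (Suc n) \<Longrightarrow> frag_extend (bd (Suc (Suc n))) (h (Suc n) x)
                 = \<phi> (Suc n) x - frag_extend (h n) (bd (Suc n) x)"
    by blast
  have "\<exists>h'. \<forall>n. \<forall>c\<in>int_chains (S n). frag_extend (h' n) (push \<pi> c) = push \<pi> (frag_extend (h n) c)"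
  proof (rule choice, rule allI)
    fix n
    show "\<exists>h'. \<forall>c\<in>int_chains (S n). frag_extend h' (push \<pi> c) = push \<pi> (frag_extend (h n) c)"
      by (rule X.ex_coinvariant_map[where \<pi>' = \<pi>, OF h(1)]) (rule X.proj_act)
  qed
  then obtain h' where h': "\<And>n c. c \<in> int_chains (S n)
      \<Longrightarrow> frag_extend (h' n) (push \<pi> c) = push \<pi> (frag_extend (h n) c)"
    by blast
  have "push \<pi> (frag_extend (bd (Suc n)) (frag_extend (h n) c)) = push \<pi> (frag_extend (\<phi> n) c)"
  proof (cases n)
    case 0
    then have "frag_extend (bd (Suc n)) (frag_extend (h n) c) = frag_extend (\<phi> n) c"
      using c(1) h(2) unfolding frag_extend_frag_extend by (auto intro: frag_extend_cong_chains)
    then show ?thesis by simp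
  next
    case (Suc m)
    have "frag_extend (bd (Suc n)) (frag_extend (h n) c)
        = frag_extend (\<lambda>x. \<phi> n x - frag_extend (h m) (bd n x)) c"
      using c(1) h(3) Suc unfolding frag_extend_frag_extend by (auto intro: frag_extend_cong_chains)
    also have "\<dots> = frag_extend (\<phi> n) c - frag_extend (h m) (frag_extend (bd n) c)"
      by (simp add: frag_extend_fun_diff frag_extend_frag_extend)
    also have "push \<pi> \<dots> = push \<pi> (frag_extend (\<phi> n) c) - frag_extend (h' m) (push \<pi> (frag_extend (bd n) c))"
      using X.bd_chains_closed c(1) Suc by (simp add: push_diff h')
    also have "push \<pi> (frag_extend (bd n) c) = 0"
      using c by (simp add: chain_cycles_iff flip: X.proj_bd_chains)
    finally show ?thesis by simp
  qed
  also have "frag_extend (\<phi> n) c = frag_extend (f' n) (frag_extend (f n) c) - c"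
    by (simp add: \<phi>_def[abs_def] frag_extend_fun_diff frag_extend_frag_extend)
  finally have "push \<pi> (frag_extend (f' n) (frag_extend (f n) c)) - push \<pi> c
      = frag_extend (bdT (Suc n)) (push \<pi> (frag_extend (h n) c))"
    using equivariant_map_frag_extend(1)[OF h(1) c(1)] by (simp add: X.proj_bd_chains push_diff)
  then show ?thesis
    using X.push_proj_closed equivariant_map_frag_extend(1)[OF h(1) c(1)]
    by (simp add: chain_boundaries_eq)
qed

theorem coinvariant_homology_unique:
  assumes X: "free_resolution_coinvariants G S act bd T \<pi> bdT"
    and Y: "free_resolution_coinvariants G S' act' bd' T' \<pi>' bdT'"
  shows "chain_homology T bdT r \<cong> chain_homology T' bdT' r"
proof -
  interpret X: free_resolution_coinvariants G S act bd T \<pi> bdT by fact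
  interpret Y: free_resolution_coinvariants G S' act' bd' T' \<pi>' bdT' by fact
  obtain f where f: "\<And>n. equivariant_map G (S n) act (S' n) act' (f n)"
    "\<And>x. x \<in> S 0 \<Longrightarrow> push (\<lambda>_. ()) (f 0 x) = frag_of ()"
    "\<And>n x. x \<in> S (Suc n) \<Longrightarrow> frag_extend (bd' (Suc n)) (f (Suc n) x) = frag_extend (f n) (bd (Suc n) x)"
    using ex_equivariant_chain_map[OF X.free_resolution_axioms Y.free_resolution_axioms] by blast
  obtain f' where f': "\<And>n. equivariant_map G (S' n) act' (S n) act (f' n)"
    "\<And>x. x \<in> S' 0 \<Longrightarrow> push (\<lambda>_. ()) (f' 0 x) = frag_of ()"
    "\<And>n x. x \<in> S' (Suc n) \<Longrightarrow> frag_extend (bd (Suc n)) (f' (Suc n) x) = frag_extend (f' n) (bd' (Suc n) x)"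
    using ex_equivariant_chain_map[OF Y.free_resolution_axioms X.free_resolution_axioms] by blast
  obtain F where F:
    "\<And>n c. c \<in> int_chains (S n) \<Longrightarrow> frag_extend (F n) (push \<pi> c) = push \<pi>' (frag_extend (f n) c)"
    "\<And>n c. c \<in> chain_cycles T bdT n \<Longrightarrow> frag_extend (F n) c \<in> chain_cycles T' bdT' n"
    "\<And>n c. c \<in> chain_boundaries T bdT n \<Longrightarrow> frag_extend (F n) c \<in> chain_boundaries T' bdT' n"
    using ex_coinvariant_chain_map[OF X Y f(1,3)] by blast
  obtain F' where F':
    "\<And>n c. c \<in> int_chains (S' n) \<Longrightarrow> frag_extend (F' n) (push \<pi>' c) = push \<pi> (frag_extend (f' n) c)"
    "\<And>n c. c \<in> chain_cycles T' bdT' n \<Longrightarrow> frag_extend (F' n) c \<in> chain_cycles T bdT n"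
    "\<And>n c. c \<in> chain_boundaries T' bdT' n \<Longrightarrow> frag_extend (F' n) c \<in> chain_boundaries T bdT n"
    using ex_coinvariant_chain_map[OF Y X f'(1,3)] by blast
  show ?thesis
  proof (rule chain_homology_isoI[OF X.boundaries_subset_cycles Y.boundaries_subset_cycles F(2,3) F'(2,3)])
    fix t assume t: "t \<in> chain_cycles T bdT r"
    then obtain c where c: "c \<in> int_chains (S r)" "t = push \<pi> c"
      using chains_image_push[OF X.proj_image] unfolding chain_cycles_iff by blast
    have "push \<pi> (frag_extend (f' r) (frag_extend (f r) c)) - push \<pi> c \<in> chain_boundaries T bdT r"
      using coinvariant_round_trip[OF X f(1,3,2) f'(1,3,2) c(1)] t c(2) by simp
    then show "frag_extend (F' r) (frag_extend (F r) t) - t \<in> chain_boundaries T bdT r"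
      using c(1) unfolding c(2) by (simp add: F(1) F'(1) equivariant_map_frag_extend(1)[OF f(1)])
  next
    fix t assume t: "t \<in> chain_cycles T' bdT' r"
    then obtain c where c: "c \<in> int_chains (S' r)" "t = push \<pi>' c"
      using chains_image_push[OF Y.proj_image] unfolding chain_cycles_iff by blast
    have "push \<pi>' (frag_extend (f r) (frag_extend (f' r) c)) - push \<pi>' c \<in> chain_boundaries T' bdT' r"
      using coinvariant_round_trip[OF Y f'(1,3,2) f(1,3,2) c(1)] t c(2) by simp
    then show "frag_extend (F r) (frag_extend (F' r) t) - t \<in> chain_boundaries T' bdT' r"
      using c(1) unfolding c(2) by (simp add: F(1) F'(1) equivariant_map_frag_extend(1)[OF f'(1)])
  qed
qed

section \<open>The bar resolution\<close>

text \<open>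
  The basis element $g_0[g_1|\cdots|g_n]$ is the list of $g_0, \ldots, g_n$. The group acts on its head,
  and the coinvariants are obtained by forgetting the head.
\<close>
definition bar_res_basis :: "('g, 'b) monoid_scheme \<Rightarrow> nat \<Rightarrow> 'g list set" where
  "bar_res_basis G n = bar_basis G (Suc n)"

definition bar_res_act :: "('g, 'b) monoid_scheme \<Rightarrow> 'g \<Rightarrow> 'g list \<Rightarrow> 'g list" where
  "bar_res_act G g xs = (g \<otimes>\<^bsub>G\<^esub> hd xs) # tl xs"

text \<open>
  In terms of this encoding the term $g_0 g_1[g_2|\cdots|g_n]$ of the boundary is the merging of the first
  two entries, like the other merging terms; the sign exponents are shifted by one because positions
  are counted from the head.
\<close>
definition bar_res_bd :: "('g, 'b) monoid_scheme \<Rightarrow> nat \<Rightarrow> 'g list \<Rightarrow> 'g list \<Rightarrow>\<^sub>0 int" where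
  "bar_res_bd G n xs =
     (if n = 0 then 0
      else (\<Sum>i = 1..n. frag_cmul ((-1) ^ Suc i) (frag_of (bar_merge G i xs)))
         + frag_cmul ((-1) ^ n) (frag_of (butlast xs)))"

context group
begin

lemma bar_res_basisE:
  assumes "xs \<in> bar_res_basis G n"
  obtains x ys where "xs = x # ys" "x \<in> carrier G" "length ys = n" "set ys \<subseteq> carrier G"
  using assms by (cases xs) (auto simp: bar_res_basis_def bar_basis_def)

lemma bar_merge_closed:
  assumes "xs \<in> bar_res_basis G (Suc n)" "i \<in> {1..Suc n}"
  shows "bar_merge G i xs \<in> bar_res_basis G n"
proof -
  have "xs ! j \<in> carrier G" if "j < Suc (Suc n)" for j
    using assms that by (auto simp: bar_res_basis_def bar_basis_def subset_eq)
  then have "xs ! (i - 1) \<otimes> xs ! i \<in> carrier G" using assms(2) by auto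
  then show ?thesis
    using assms set_take_subset[of "i - 1" xs] set_drop_subset[of "i + 1" xs]
    by (auto simp: bar_res_basis_def bar_basis_def bar_merge_def)
qed

lemma bar_butlast_closed:
  "xs \<in> bar_res_basis G (Suc n) \<Longrightarrow> butlast xs \<in> bar_res_basis G n"
  by (auto simp: bar_res_basis_def bar_basis_def dest: in_set_butlastD)

lemma bar_res_bd_closed:
  assumes "xs \<in> bar_res_basis G (Suc n)"
  shows "bar_res_bd G (Suc n) xs \<in> int_chains (bar_res_basis G n)"
  unfolding bar_res_bd_def using bar_merge_closed[OF assms] bar_butlast_closed[OF assms]
  by (auto intro!: chains_add chains_sum chains_cmul)

lemma bar_merge_act:
  assumes "g \<in> carrier G" "xs \<in> bar_res_basis G (Suc n)" "i \<ge> 1"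
  shows "bar_merge G i (bar_res_act G g xs) = bar_res_act G g (bar_merge G i xs)"
proof -
  obtain x ys where xs: "xs = x # ys" "x \<in> carrier G" "length ys = Suc n" "set ys \<subseteq> carrier G"
    using assms(2) by (rule bar_res_basisE)
  then obtain y zs where "ys = y # zs" "y \<in> carrier G" by (cases ys) auto
  moreover obtain j where "i = Suc j" using assms(3) by (cases i) auto
  ultimately show ?thesis
    using xs assms(1) by (cases j) (auto simp: bar_merge_def bar_res_act_def m_assoc)
qed

lemma bar_res_bd_act:
  assumes "g \<in> carrier G" "xs \<in> bar_res_basis G (Suc n)"
  shows "bar_res_bd G (Suc n) (bar_res_act G g xs) = push (bar_res_act G g) (bar_res_bd G (Suc n) xs)"
proof -
  have "butlast (bar_res_act G g xs) = bar_res_act G g (butlast xs)"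
    using assms(2) by (elim bar_res_basisE) (auto simp: bar_res_act_def)
  then show ?thesis
    using bar_merge_act[OF assms]
    by (simp add: bar_res_bd_def push_add push_sum push_cmul)
qed

text \<open>
  This is the contracting homotopy $\partial s + s \partial = \mathrm{id}$ with $s(x) = 1 \cdot [x]$: the
  first merging multiplies the head of $x$ by the unit, and the other terms are those of $\partial x$
  with the unit in front and the sign reversed. In degree $0$ the augmentation takes the place of
  $\partial$.
\<close>
lemma bar_res_bd_one_Cons:
  assumes "xs \<in> bar_res_basis G n"
  shows "bar_res_bd G (Suc n) (\<one> # xs)
           = frag_of xs - (if n = 0 then frag_of [\<one>] else push ((#) \<one>) (bar_res_bd G n xs))"
proof -
  obtain x ys where xs: "xs = x # ys" "x \<in> carrier G" "length ys = n"
    using assms by (rule bar_res_basisE)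
  have first: "bar_merge G (Suc 0) (\<one> # xs) = xs"
    using xs by (simp add: bar_merge_def)
  have merge: "bar_merge G (Suc i) (\<one> # xs) = \<one> # bar_merge G i xs" if "i \<ge> 1" for i
    using that by (cases i) (auto simp: bar_merge_def)
  have "(\<Sum>i = 1..Suc n. frag_cmul ((-1) ^ Suc i) (frag_of (bar_merge G i (\<one> # xs))))
      = frag_of xs + (\<Sum>i = Suc 1..Suc n. frag_cmul ((-1) ^ Suc i) (frag_of (bar_merge G i (\<one> # xs))))"
    by (subst sum.atLeast_Suc_atMost) (auto simp: first)
  also have "(\<Sum>i = Suc 1..Suc n. frag_cmul ((-1) ^ Suc i) (frag_of (bar_merge G i (\<one> # xs))))
      = (\<Sum>i = 1..n. - push ((#) \<one>) (frag_cmul ((-1) ^ Suc i) (frag_of (bar_merge G i xs))))"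
    unfolding sum.shift_bounds_cl_Suc_ivl
    by (rule sum.cong) (auto simp: merge push_cmul push_minus simp flip: minus_frag_cmul)
  finally show ?thesis
    using xs by (auto simp: bar_res_bd_def push_add push_sum push_cmul push_diff push_minus sum_negf simp flip: minus_frag_cmul)
qed

lemma bar_contraction:
  assumes c: "c \<in> int_chains (bar_res_basis G n)" and "augmented_cycle (bar_res_bd G) n c"
  shows "frag_extend (bar_res_bd G (Suc n)) (push ((#) \<one>) c) = c"
proof -
  have "frag_extend (bar_res_bd G (Suc n)) (push ((#) \<one>) c)
      = frag_extend (\<lambda>xs. frag_of xs
          - (if n = 0 then frag_of [\<one>] else push ((#) \<one>) (bar_res_bd G n xs))) c"
    unfolding frag_extend_push by (rule frag_extend_cong_chains[OF c]) (rule bar_res_bd_one_Cons)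
  also have "\<dots> = c"
  proof (cases "n = 0")
    case True
    have "frag_extend (\<lambda>_. frag_of [\<one>]) c = push (\<lambda>_. [\<one>]) (push (\<lambda>_. ()) c)"
      unfolding push_push by (simp add: push_def o_def)
    also have "\<dots> = 0" using assms(2) True by (simp add: augmented_cycle_def)
    finally show ?thesis using True by (simp add: frag_extend_fun_diff)
  next
    case False
    then show ?thesis
      using assms(2) by (simp add: frag_extend_fun_diff augmented_cycle_def flip: push_frag_extend)
  qed
  finally show ?thesis .
qed

text \<open>
  Every basis element in positive degree is a translate of some
  $s(y)$, and $\partial\partial s(y) = \partial(y - s \partial y) = \partial y - \partial s (\partial y) = 0$
  by the contraction property for the cycle $\partial y$.
\<close>
lemma bar_res_bd_cycle:
  "xs \<in> bar_res_basis G (Suc n) \<Longrightarrow> augmented_cycle (bar_res_bd G) n (bar_res_bd G (Suc n) xs)"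
proof (induction n arbitrary: xs)
  case 0
  then show ?case by (simp add: augmented_cycle_def bar_res_bd_def push_diff)
next
  case (Suc n)
  obtain g ys where xs: "xs = g # ys" "g \<in> carrier G" "length ys = Suc (Suc n)" "set ys \<subseteq> carrier G"
    using Suc.prems by (rule bar_res_basisE)
  then have ys: "ys \<in> bar_res_basis G (Suc n)" "\<one> # ys \<in> bar_res_basis G (Suc (Suc n))"
    by (auto simp: bar_res_basis_def bar_basis_def)
  let ?c = "bar_res_bd G (Suc n) ys"
  have c: "?c \<in> int_chains (bar_res_basis G n)" by (rule bar_res_bd_closed[OF ys(1)])
  have closed: "frag_of ys - push ((#) \<one>) ?c \<in> int_chains (bar_res_basis G (Suc n))"
    using ys by (intro chains_diff chains_push[OF c]) (auto simp: bar_res_basis_def bar_basis_def)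
  have "xs = bar_res_act G g (\<one> # ys)" using xs by (simp add: bar_res_act_def)
  then have "bar_res_bd G (Suc (Suc n)) xs = push (bar_res_act G g) (frag_of ys - push ((#) \<one>) ?c)"
    using bar_res_bd_act[OF xs(2) ys(2)] bar_res_bd_one_Cons[OF ys(1)] by simp
  then have "frag_extend (bar_res_bd G (Suc n)) (bar_res_bd G (Suc (Suc n)) xs)
      = push (bar_res_act G g) (frag_extend (bar_res_bd G (Suc n)) (frag_of ys - push ((#) \<one>) ?c))"
    by (simp only: push_frag_extend frag_extend_push)
       (rule frag_extend_cong_chains[OF closed bar_res_bd_act[OF xs(2)]])
  also have "\<dots> = 0"
    using bar_contraction[OF c Suc.IH[OF ys(1)]] by (simp add: frag_extend_diff)
  finally show ?case by (simp add: augmented_cycle_def)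
qed

lemma bar_free_resolution:
  "free_resolution G (bar_res_basis G) (bar_res_act G) (bar_res_bd G)"
proof
  show "bar_res_act G g xs \<in> bar_res_basis G n" if "g \<in> carrier G" "xs \<in> bar_res_basis G n" for g xs n
    using that(1) by (rule_tac bar_res_basisE[OF that(2)])
      (auto simp: bar_res_act_def bar_res_basis_def bar_basis_def)
  show "bar_res_act G \<one> xs = xs" if "xs \<in> bar_res_basis G n" for xs n
    by (rule bar_res_basisE[OF that]) (simp add: bar_res_act_def)
  show "bar_res_act G (g \<otimes> h) xs = bar_res_act G g (bar_res_act G h xs)"
    if "g \<in> carrier G" "h \<in> carrier G" "xs \<in> bar_res_basis G n" for g h xs n
    using that(1,2) by (rule_tac bar_res_basisE[OF that(3)]) (simp add: bar_res_act_def m_assoc)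
  show "g = \<one>" if "g \<in> carrier G" "xs \<in> bar_res_basis G n" "bar_res_act G g xs = xs" for g xs n
    using that(1,3) by (rule_tac bar_res_basisE[OF that(2)]) (simp add: bar_res_act_def)
  have "[\<one>] \<in> bar_res_basis G 0" by (simp add: bar_res_basis_def bar_basis_def)
  then show "bar_res_basis G 0 \<noteq> {}" by blast
  show "bar_res_bd G 0 xs = 0" for xs by (simp add: bar_res_bd_def)
  show "\<exists>b\<in>int_chains (bar_res_basis G (Suc n)). frag_extend (bar_res_bd G (Suc n)) b = c"
    if "c \<in> int_chains (bar_res_basis G n)" "augmented_cycle (bar_res_bd G) n c" for c n
  proof (rule bexI[of _ "push ((#) \<one>) c"])
    show "frag_extend (bar_res_bd G (Suc n)) (push ((#) \<one>) c) = c" by (rule bar_contraction[OF that])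
    show "push ((#) \<one>) c \<in> int_chains (bar_res_basis G (Suc n))"
      by (rule chains_push[OF that(1)]) (simp add: bar_res_basis_def bar_basis_def)
  qed
qed (fact bar_res_bd_closed bar_res_bd_act bar_res_bd_cycle)+

lemma bar_boundary_tl:
  assumes "xs \<in> bar_res_basis G n"
  shows "bar_boundary G n (tl xs) = push tl (bar_res_bd G n xs)"
proof (cases n)
  case 0
  then show ?thesis by (simp add: bar_boundary_def bar_res_bd_def)
next
  case (Suc m)
  obtain x ys where xs: "xs = x # ys" "length ys = n"
    using assms by (rule bar_res_basisE)
  have first: "tl (bar_merge G (Suc 0) xs) = tl ys"
    using xs by (cases ys) (auto simp: bar_merge_def)
  have merge: "tl (bar_merge G (Suc i) xs) = bar_merge G i ys" if "i \<ge> 1" for i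
    using that xs by (cases i) (auto simp: bar_merge_def)
  have "push tl (\<Sum>i = 1..Suc m. frag_cmul ((-1) ^ Suc i) (frag_of (bar_merge G i xs)))
      = (\<Sum>i = 1..Suc m. frag_cmul ((-1) ^ Suc i) (frag_of (tl (bar_merge G i xs))))"
    by (simp only: push_sum push_cmul push_frag_of)
  also have "\<dots> = frag_of (tl ys)
      + (\<Sum>i = Suc 1..Suc m. frag_cmul ((-1) ^ Suc i) (frag_of (tl (bar_merge G i xs))))"
    by (subst sum.atLeast_Suc_atMost) (auto simp: first)
  also have "(\<Sum>i = Suc 1..Suc m. frag_cmul ((-1) ^ Suc i) (frag_of (tl (bar_merge G i xs))))
      = (\<Sum>i = 1..m. frag_cmul ((-1) ^ i) (frag_of (bar_merge G i ys)))"
    unfolding sum.shift_bounds_cl_Suc_ivl by (rule sum.cong) (auto simp: merge)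
  moreover have "tl (butlast xs) = butlast ys" using xs Suc by auto
  ultimately show ?thesis
    using xs Suc by (simp add: bar_boundary_def bar_res_bd_def push_add push_cmul)
qed

lemma bar_coinvariants:
  "free_resolution_coinvariants G (bar_res_basis G) (bar_res_act G) (bar_res_bd G)
     (bar_basis G) tl (bar_boundary G)"
proof (intro free_resolution_coinvariants.intro bar_free_resolution
    free_resolution_coinvariants_axioms.intro)
  show "tl ` bar_res_basis G n = bar_basis G n" for n
  proof (intro equalityI subsetI)
    fix ys assume "ys \<in> bar_basis G n"
    then show "ys \<in> tl ` bar_res_basis G n"
      by (intro image_eqI[of _ _ "\<one> # ys"]) (auto simp: bar_res_basis_def bar_basis_def)
  qed (auto simp: bar_basis_def elim!: bar_res_basisE)
  show "tl (bar_res_act G g xs) = tl xs" for g xs by (simp add: bar_res_act_def)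
  show "\<exists>g\<in>carrier G. ys = bar_res_act G g xs"
    if tuples: "xs \<in> bar_res_basis G n" "ys \<in> bar_res_basis G n" "tl xs = tl ys" for xs ys n
  proof -
    obtain x xs' where x: "xs = x # xs'" "x \<in> carrier G" using tuples(1) by (rule bar_res_basisE)
    obtain y ys' where y: "ys = y # ys'" "y \<in> carrier G" using tuples(2) by (rule bar_res_basisE)
    show ?thesis
      using x y tuples(3) by (intro bexI[of _ "y \<otimes> inv x"]) (auto simp: bar_res_act_def m_assoc)
  qed
qed (rule bar_boundary_tl)

end

section \<open>Segments of morphisms\<close>

text \<open>
  Front and back faces of a cube are both middle factors of three-fold factorisations, with $m = 0$ and
  $m = e_i$ respectively, and so is a face of a face. The degree of the last factor is determined by the
  others.
\<close>
definition segment :: "'a kgraph \<Rightarrow> 'a \<Rightarrow> (nat \<Rightarrow> nat) \<Rightarrow> 'a \<Rightarrow> bool" where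
  "segment \<Lambda> \<xi> m \<mu> \<longleftrightarrow> \<mu> \<in> mor \<Lambda> \<and> (\<exists>\<alpha>\<in>mor \<Lambda>. \<exists>\<beta>\<in>mor \<Lambda>. src \<Lambda> \<alpha> = rng \<Lambda> \<mu> \<and> src \<Lambda> \<mu> = rng \<Lambda> \<beta>
      \<and> deg \<Lambda> \<alpha> = m \<and> \<xi> = cmp \<Lambda> \<alpha> (cmp \<Lambda> \<mu> \<beta>))"

definition subcube :: "'a kgraph \<Rightarrow> 'a \<Rightarrow> (nat \<Rightarrow> nat) \<Rightarrow> (nat \<Rightarrow> nat) \<Rightarrow> 'a" where
  "subcube \<Lambda> \<xi> m n = (THE \<mu>. segment \<Lambda> \<xi> m \<mu> \<and> deg \<Lambda> \<mu> = n)"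

context kgraph
begin

lemma Nk_mono: "n \<in> Nk k \<Longrightarrow> m \<le> n \<Longrightarrow> m \<in> Nk k"
  unfolding Nk_def
proof safe
  fix i assume "\<forall>i. i \<notin> {1..k} \<longrightarrow> n i = 0" "m \<le> n" "i \<notin> {1..k}"
  then show "m i = 0" using le_funD[of m n i] by simp
qed

lemma factor_ex:
  assumes "\<xi> \<in> mor \<Lambda>" "deg \<Lambda> \<xi> = m + n"
  obtains \<mu> \<nu> where "\<mu> \<in> mor \<Lambda>" "\<nu> \<in> mor \<Lambda>" "deg \<Lambda> \<mu> = m" "deg \<Lambda> \<nu> = n"
    "src \<Lambda> \<mu> = rng \<Lambda> \<nu>" "\<xi> = cmp \<Lambda> \<mu> \<nu>"
proof -
  have "m \<in> Nk k" "n \<in> Nk k"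
    using Nk_mono[OF deg_Nk[OF assms(1)]] assms(2) by (auto simp: le_fun_def)
  from factorisation[OF assms(1) this assms(2)] show ?thesis
    by (elim ex1E) (auto intro: that)
qed

lemma factor_unique:
  assumes "\<mu> \<in> mor \<Lambda>" "\<nu> \<in> mor \<Lambda>" "src \<Lambda> \<mu> = rng \<Lambda> \<nu>"
    and "\<mu>' \<in> mor \<Lambda>" "\<nu>' \<in> mor \<Lambda>" "src \<Lambda> \<mu>' = rng \<Lambda> \<nu>'"
    and eq: "cmp \<Lambda> \<mu> \<nu> = cmp \<Lambda> \<mu>' \<nu>'" "deg \<Lambda> \<mu> = deg \<Lambda> \<mu>'"
  shows "\<mu> = \<mu>' \<and> \<nu> = \<nu>'"
proof -
  have "deg \<Lambda> \<mu> + deg \<Lambda> \<nu> = deg \<Lambda> \<mu> + deg \<Lambda> \<nu>'"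
    using eq deg_cmp[OF assms(1-3)] deg_cmp[OF assms(4-6)] by simp
  then have "deg \<Lambda> \<nu> = deg \<Lambda> \<nu>'" by (simp only: add_left_cancel)
  moreover define P where "P = (\<lambda>(a, b). a \<in> mor \<Lambda> \<and> b \<in> mor \<Lambda> \<and> deg \<Lambda> a = deg \<Lambda> \<mu> \<and>
    deg \<Lambda> b = deg \<Lambda> \<nu> \<and> src \<Lambda> a = rng \<Lambda> b \<and> cmp \<Lambda> \<mu> \<nu> = cmp \<Lambda> a b)"
  ultimately have "P (\<mu>, \<nu>)" "P (\<mu>', \<nu>')"
    using assms by simp_all
  moreover have "\<exists>!p. P p"
    unfolding P_def by (rule factorisation[OF cmp_mor deg_Nk deg_Nk deg_cmp]) (use assms in auto)
  ultimately have "(\<mu>, \<nu>) = (\<mu>', \<nu>')" by blast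
  then show ?thesis by simp
qed

lemma segment_unique:
  assumes "segment \<Lambda> \<xi> m \<mu>" "segment \<Lambda> \<xi> m \<nu>" "deg \<Lambda> \<mu> = deg \<Lambda> \<nu>"
  shows "\<mu> = \<nu>"
proof -
  obtain \<alpha> \<beta> where 1: "\<mu> \<in> mor \<Lambda>" "\<alpha> \<in> mor \<Lambda>" "\<beta> \<in> mor \<Lambda>" "src \<Lambda> \<alpha> = rng \<Lambda> \<mu>" "src \<Lambda> \<mu> = rng \<Lambda> \<beta>"
    "deg \<Lambda> \<alpha> = m" "\<xi> = cmp \<Lambda> \<alpha> (cmp \<Lambda> \<mu> \<beta>)"
    using assms(1) unfolding segment_def by blast
  obtain \<alpha>' \<beta>' where 2: "\<nu> \<in> mor \<Lambda>" "\<alpha>' \<in> mor \<Lambda>" "\<beta>' \<in> mor \<Lambda>" "src \<Lambda> \<alpha>' = rng \<Lambda> \<nu>" "src \<Lambda> \<nu> = rng \<Lambda> \<beta>'"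
    "deg \<Lambda> \<alpha>' = m" "\<xi> = cmp \<Lambda> \<alpha>' (cmp \<Lambda> \<nu> \<beta>')"
    using assms(2) unfolding segment_def by blast
  have "cmp \<Lambda> \<mu> \<beta> = cmp \<Lambda> \<nu> \<beta>'"
    using factor_unique[of \<alpha> "cmp \<Lambda> \<mu> \<beta>" \<alpha>' "cmp \<Lambda> \<nu> \<beta>'"] 1 2 by (simp add: cmp_mor rng_cmp)
  then show ?thesis
    using factor_unique[of \<mu> \<beta> \<nu> \<beta>'] 1 2 assms(3) by simp
qed

lemma segment_ex:
  assumes "\<xi> \<in> mor \<Lambda>" "m + n \<le> deg \<Lambda> \<xi>"
  shows "\<exists>\<mu>. segment \<Lambda> \<xi> m \<mu> \<and> deg \<Lambda> \<mu> = n"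
proof -
  define p where "p = deg \<Lambda> \<xi> - m - n"
  have "deg \<Lambda> \<xi> = m + (n + p)"
  proof
    fix i
    show "deg \<Lambda> \<xi> i = (m + (n + p)) i" using le_funD[OF assms(2), of i] by (simp add: p_def)
  qed
  then obtain \<alpha> \<nu> where 1: "\<alpha> \<in> mor \<Lambda>" "\<nu> \<in> mor \<Lambda>" "deg \<Lambda> \<alpha> = m" "deg \<Lambda> \<nu> = n + p"
    "src \<Lambda> \<alpha> = rng \<Lambda> \<nu>" "\<xi> = cmp \<Lambda> \<alpha> \<nu>"
    using factor_ex[OF assms(1)] by blast
  obtain \<mu> \<beta> where 2: "\<mu> \<in> mor \<Lambda>" "\<beta> \<in> mor \<Lambda>" "deg \<Lambda> \<mu> = n" "deg \<Lambda> \<beta> = p"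
    "src \<Lambda> \<mu> = rng \<Lambda> \<beta>" "\<nu> = cmp \<Lambda> \<mu> \<beta>"
    using factor_ex[OF 1(2,4)] by blast
  then have "rng \<Lambda> \<nu> = rng \<Lambda> \<mu>" by (simp add: rng_cmp)
  then have "segment \<Lambda> \<xi> m \<mu>" unfolding segment_def using 1 2 by auto
  then show ?thesis using 2 by blast
qed

lemma segment_trans:
  assumes "segment \<Lambda> \<xi> m \<mu>" "segment \<Lambda> \<mu> m' \<nu>"
  shows "segment \<Lambda> \<xi> (m + m') \<nu>"
proof -
  obtain \<alpha> \<beta> where 1: "\<mu> \<in> mor \<Lambda>" "\<alpha> \<in> mor \<Lambda>" "\<beta> \<in> mor \<Lambda>" "src \<Lambda> \<alpha> = rng \<Lambda> \<mu>" "src \<Lambda> \<mu> = rng \<Lambda> \<beta>"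
    "deg \<Lambda> \<alpha> = m" "\<xi> = cmp \<Lambda> \<alpha> (cmp \<Lambda> \<mu> \<beta>)"
    using assms(1) unfolding segment_def by blast
  obtain \<alpha>' \<beta>' where 2: "\<nu> \<in> mor \<Lambda>" "\<alpha>' \<in> mor \<Lambda>" "\<beta>' \<in> mor \<Lambda>" "src \<Lambda> \<alpha>' = rng \<Lambda> \<nu>" "src \<Lambda> \<nu> = rng \<Lambda> \<beta>'"
    "deg \<Lambda> \<alpha>' = m'" "\<mu> = cmp \<Lambda> \<alpha>' (cmp \<Lambda> \<nu> \<beta>')"
    using assms(2) unfolding segment_def by blast
  have \<nu>\<beta>: "cmp \<Lambda> \<nu> \<beta>' \<in> mor \<Lambda>" "rng \<Lambda> (cmp \<Lambda> \<nu> \<beta>') = rng \<Lambda> \<nu>" "src \<Lambda> (cmp \<Lambda> \<nu> \<beta>') = src \<Lambda> \<beta>'"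
    using 2 by (simp_all add: cmp_mor rng_cmp src_cmp)
  then have rs: "rng \<Lambda> \<mu> = rng \<Lambda> \<alpha>'" "src \<Lambda> \<mu> = src \<Lambda> \<beta>'"
    using 2 by (simp_all add: rng_cmp src_cmp)
  have \<beta>\<beta>: "cmp \<Lambda> \<beta>' \<beta> \<in> mor \<Lambda>" "rng \<Lambda> (cmp \<Lambda> \<beta>' \<beta>) = rng \<Lambda> \<beta>'"
    using 1 2 rs by (simp_all add: cmp_mor rng_cmp)
  have "cmp \<Lambda> \<mu> \<beta> = cmp \<Lambda> \<alpha>' (cmp \<Lambda> (cmp \<Lambda> \<nu> \<beta>') \<beta>)"
    using 1 2 \<nu>\<beta> rs by (simp add: cmp_assoc)
  also have "cmp \<Lambda> (cmp \<Lambda> \<nu> \<beta>') \<beta> = cmp \<Lambda> \<nu> (cmp \<Lambda> \<beta>' \<beta>)"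
    using 1 2 rs by (intro cmp_assoc) auto
  finally have "\<xi> = cmp \<Lambda> (cmp \<Lambda> \<alpha> \<alpha>') (cmp \<Lambda> \<nu> (cmp \<Lambda> \<beta>' \<beta>))"
    using 1 2 rs \<beta>\<beta> by (subst cmp_assoc) (auto simp: cmp_mor rng_cmp)
  moreover have "cmp \<Lambda> \<alpha> \<alpha>' \<in> mor \<Lambda>" "src \<Lambda> (cmp \<Lambda> \<alpha> \<alpha>') = rng \<Lambda> \<nu>" "deg \<Lambda> (cmp \<Lambda> \<alpha> \<alpha>') = m + m'"
    using 1 2 rs by (simp_all add: cmp_mor src_cmp deg_cmp)
  ultimately show ?thesis
    unfolding segment_def using 2 \<beta>\<beta> by metis
qed

lemma subcube:
  assumes "\<xi> \<in> mor \<Lambda>" "m + n \<le> deg \<Lambda> \<xi>"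
  shows "segment \<Lambda> \<xi> m (subcube \<Lambda> \<xi> m n)" "deg \<Lambda> (subcube \<Lambda> \<xi> m n) = n"
    "subcube \<Lambda> \<xi> m n \<in> mor \<Lambda>"
proof -
  have "\<exists>!\<mu>. segment \<Lambda> \<xi> m \<mu> \<and> deg \<Lambda> \<mu> = n"
    using segment_ex[OF assms] segment_unique by blast
  then have "segment \<Lambda> \<xi> m (subcube \<Lambda> \<xi> m n) \<and> deg \<Lambda> (subcube \<Lambda> \<xi> m n) = n"
    unfolding subcube_def by (rule theI')
  then show "segment \<Lambda> \<xi> m (subcube \<Lambda> \<xi> m n)" "deg \<Lambda> (subcube \<Lambda> \<xi> m n) = n"
    "subcube \<Lambda> \<xi> m n \<in> mor \<Lambda>" by (auto simp: segment_def)
qed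

lemma subcube_eqI:
  "segment \<Lambda> \<xi> m \<mu> \<Longrightarrow> deg \<Lambda> \<mu> = n \<Longrightarrow> subcube \<Lambda> \<xi> m n = \<mu>"
  unfolding subcube_def by (rule the_equality) (simp, rule segment_unique[of \<xi> m], simp_all)

text \<open>
  Middle factors compose by adding their offsets. This single rule contains all the commutation relations
  between front and back faces.
\<close>
lemma subcube_subcube:
  assumes "\<xi> \<in> mor \<Lambda>" "m + n \<le> deg \<Lambda> \<xi>" "m' + n' \<le> n"
  shows "subcube \<Lambda> (subcube \<Lambda> \<xi> m n) m' n' = subcube \<Lambda> \<xi> (m + m') n'"
proof -
  let ?\<mu> = "subcube \<Lambda> \<xi> m n"
  have \<mu>: "segment \<Lambda> \<xi> m ?\<mu>" "?\<mu> \<in> mor \<Lambda>" "m' + n' \<le> deg \<Lambda> ?\<mu>"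
    using subcube[OF assms(1,2)] assms(3) by auto
  show ?thesis
    by (rule subcube_eqI[symmetric]) (use segment_trans[OF \<mu>(1)] subcube[OF \<mu>(2,3)] in auto)
qed

end

section \<open>Faces of cubes\<close>

definition directions :: "'a kgraph \<Rightarrow> 'a \<Rightarrow> nat set" where
  "directions \<Lambda> \<xi> = {i. deg \<Lambda> \<xi> i \<noteq> 0}"

text \<open>
  Faces indexed by the coordinate that is removed, instead of its position among the directions of the
  cube: under this indexing the faces in two directions commute without any shift of indices.
\<close>
definition direction_face :: "'a kgraph \<Rightarrow> 'a \<Rightarrow> nat \<Rightarrow> nat \<Rightarrow> 'a" where
  "direction_face \<Lambda> \<xi> l i =
     subcube \<Lambda> \<xi> (if l = 0 then 0 else unit_deg i) (deg \<Lambda> \<xi> - unit_deg i)"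

text \<open>
  The two kinds of faces differ only in the side on which the complementary edge stands; they are treated
  together through the predicate that characterises them.
\<close>
definition is_face :: "nat \<Rightarrow> 'a kgraph \<Rightarrow> nat \<Rightarrow> nat \<Rightarrow> nat \<Rightarrow> 'a \<Rightarrow> 'a \<Rightarrow> bool" where
  "is_face k \<Lambda> r l j \<xi> \<mu> \<longleftrightarrow> \<mu> \<in> cubes k \<Lambda> (r - 1) \<and>
     (\<exists>\<beta>\<in>mor \<Lambda>. deg \<Lambda> \<beta> = unit_deg (cube_dir \<Lambda> \<xi> j) \<and>
        (if l = 0 then src \<Lambda> \<mu> = rng \<Lambda> \<beta> \<and> \<xi> = cmp \<Lambda> \<mu> \<beta>
         else src \<Lambda> \<beta> = rng \<Lambda> \<mu> \<and> \<xi> = cmp \<Lambda> \<beta> \<mu>))"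

lemma face_eq_The_is_face: "face k \<Lambda> r l j \<xi> = (THE \<mu>. is_face k \<Lambda> r l j \<xi> \<mu>)"
  by (simp add: face_def face0_def face1_def is_face_def)

lemma card_less_nth_sorted_list_of_set:
  fixes D :: "nat set"
  assumes "finite D" "n < card D"
  shows "card {i \<in> D. i < sorted_list_of_set D ! n} = n"
proof -
  let ?s = "sorted_list_of_set D"
  have sorted: "sorted_wrt (<) ?s" by simp
  have len: "length ?s = card D" by simp
  have lt: "?s ! a < ?s ! b \<longleftrightarrow> a < b" if "a < card D" "b < card D" for a b
    using that sorted_wrt_nth_less[OF sorted, of a b] sorted_wrt_nth_less[OF sorted, of b a] len
    by (metis linorder_neqE_nat not_less_iff_gr_or_eq)
  have "D = (!) ?s ` {..<card D}"
    using assms(1) len set_conv_nth[of ?s] by auto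
  then have "{i \<in> D. i < ?s ! n} = {i \<in> (!) ?s ` {..<card D}. i < ?s ! n}" by simp
  also have "\<dots> = (!) ?s ` {..<n}" using lt assms(2) by auto
  also have "card \<dots> = card {..<n}"
  proof (rule card_image)
    show "inj_on ((!) ?s) {..<n}"
      using assms(2) by (intro inj_on_nth) auto
  qed
  finally show ?thesis by simp
qed

lemma bij_betw_sorted_list_of_set:
  fixes D :: "nat set"
  assumes "finite D"
  shows "bij_betw (\<lambda>j. sorted_list_of_set D ! (j - 1)) {1..card D} D"
proof -
  have "bij_betw ((!) (sorted_list_of_set D)) {..<card D} D"
    using assms by (intro bij_betw_nth) auto
  moreover have "bij_betw (\<lambda>j. j - 1) {1..card D} {..<card D}"
    by (rule bij_betwI[of _ _ _ Suc]) auto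
  ultimately show ?thesis
    using bij_betw_trans unfolding comp_def by fastforce
qed

context kgraph
begin

lemma finite_directions: "\<xi> \<in> mor \<Lambda> \<Longrightarrow> finite (directions \<Lambda> \<xi>)"
  by (rule finite_subset[of _ "{1..k}"]) (use deg_Nk[of \<xi>] in \<open>auto simp: directions_def Nk_def\<close>)

lemma cubes_iff_card_directions:
  "\<xi> \<in> cubes k \<Lambda> r \<longleftrightarrow> \<xi> \<in> mor \<Lambda> \<and> deg \<Lambda> \<xi> \<le> ones k \<and> card (directions \<Lambda> \<xi>) = r"
proof -
  have "deg_size k (deg \<Lambda> \<xi>) = card (directions \<Lambda> \<xi>)" if "\<xi> \<in> mor \<Lambda>" and le: "deg \<Lambda> \<xi> \<le> ones k"
  proof -
    have sub: "directions \<Lambda> \<xi> \<subseteq> {1..k}"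
      using deg_Nk[OF that(1)] by (auto simp: directions_def Nk_def)
    have "deg \<Lambda> \<xi> i = (if i \<in> directions \<Lambda> \<xi> then 1 else 0)" for i
      using le_funD[OF le, of i] by (auto simp: directions_def ones_def split: if_splits)
    then have "deg_size k (deg \<Lambda> \<xi>) = (\<Sum>i = 1..k. if i \<in> directions \<Lambda> \<xi> then 1 else 0)"
      unfolding deg_size_def by (intro sum.cong) auto
    also have "\<dots> = card (directions \<Lambda> \<xi>)"
      using sub by (simp add: Int_absorb1 flip: sum.inter_restrict)
    finally show ?thesis .
  qed
  then show ?thesis by (auto simp: cubes_def)
qed

lemma cube_dir_in_directions:
  assumes "\<xi> \<in> cubes k \<Lambda> r" "j \<in> {1..r}"
  shows "cube_dir \<Lambda> \<xi> j \<in> directions \<Lambda> \<xi>"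
proof -
  have "finite (directions \<Lambda> \<xi>)" "card (directions \<Lambda> \<xi>) = r"
    using assms(1) finite_directions by (auto simp: cubes_iff_card_directions)
  then show ?thesis
    using bij_betwE[OF bij_betw_sorted_list_of_set[of "directions \<Lambda> \<xi>"]] assms(2)
    unfolding cube_dir_def directions_def[symmetric] by blast
qed

lemma
  assumes "\<xi> \<in> cubes k \<Lambda> r" "i \<in> directions \<Lambda> \<xi>"
  shows direction_face_cube: "direction_face \<Lambda> \<xi> l i \<in> cubes k \<Lambda> (r - 1)"
    and directions_direction_face:
      "directions \<Lambda> (direction_face \<Lambda> \<xi> l i) = directions \<Lambda> \<xi> - {i}"
    and deg_direction_face: "deg \<Lambda> (direction_face \<Lambda> \<xi> l i) = deg \<Lambda> \<xi> - unit_deg i"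
proof -
  have \<xi>: "\<xi> \<in> mor \<Lambda>" "deg \<Lambda> \<xi> \<le> ones k" "card (directions \<Lambda> \<xi>) = r"
    using assms(1) by (auto simp: cubes_iff_card_directions)
  have le: "(if l = 0 then 0 else unit_deg i) + (deg \<Lambda> \<xi> - unit_deg i) \<le> deg \<Lambda> \<xi>"
    using assms(2) by (auto simp: le_fun_def unit_deg_def directions_def)
  show deg: "deg \<Lambda> (direction_face \<Lambda> \<xi> l i) = deg \<Lambda> \<xi> - unit_deg i"
    and "directions \<Lambda> (direction_face \<Lambda> \<xi> l i) = directions \<Lambda> \<xi> - {i}"
  proof -
    show deg: "deg \<Lambda> (direction_face \<Lambda> \<xi> l i) = deg \<Lambda> \<xi> - unit_deg i"
      unfolding direction_face_def by (rule subcube(2)[OF \<xi>(1) le])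
    have "deg \<Lambda> \<xi> i = 1"
      using le_funD[OF \<xi>(2), of i] assms(2) by (auto simp: directions_def ones_def split: if_splits)
    then show "directions \<Lambda> (direction_face \<Lambda> \<xi> l i) = directions \<Lambda> \<xi> - {i}"
      unfolding directions_def deg by (auto simp: unit_deg_def split: if_splits)
  qed
  moreover have "direction_face \<Lambda> \<xi> l i \<in> mor \<Lambda>"
    unfolding direction_face_def by (rule subcube(3)[OF \<xi>(1) le])
  moreover have "deg \<Lambda> \<xi> - unit_deg i \<le> ones k"
    using \<xi>(2) by (auto simp: le_fun_def intro: le_trans[OF diff_le_self])
  ultimately show "direction_face \<Lambda> \<xi> l i \<in> cubes k \<Lambda> (r - 1)"
    using \<xi> finite_directions assms(2) by (simp add: cubes_iff_card_directions)
qed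

lemma is_face_iff:
  assumes "\<xi> \<in> cubes k \<Lambda> r" "j \<in> {1..r}"
  shows "is_face k \<Lambda> r l j \<xi> \<mu> \<longleftrightarrow> \<mu> = direction_face \<Lambda> \<xi> l (cube_dir \<Lambda> \<xi> j)"
proof -
  let ?i = "cube_dir \<Lambda> \<xi> j"
  have i: "?i \<in> directions \<Lambda> \<xi>" by (rule cube_dir_in_directions[OF assms])
  have \<xi>: "\<xi> \<in> mor \<Lambda>" using assms(1) by (simp add: cubes_def)
  have unique: "\<mu> = direction_face \<Lambda> \<xi> l ?i" if face: "is_face k \<Lambda> r l j \<xi> \<mu>" for \<mu>
  proof -
    obtain \<beta> where \<mu>: "\<mu> \<in> mor \<Lambda>" and \<beta>: "\<beta> \<in> mor \<Lambda>" "deg \<Lambda> \<beta> = unit_deg ?i"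
      and cmp: "if l = 0 then src \<Lambda> \<mu> = rng \<Lambda> \<beta> \<and> \<xi> = cmp \<Lambda> \<mu> \<beta>
         else src \<Lambda> \<beta> = rng \<Lambda> \<mu> \<and> \<xi> = cmp \<Lambda> \<beta> \<mu>"
      using face by (auto simp: is_face_def cubes_def)
    have "segment \<Lambda> \<xi> (if l = 0 then 0 else unit_deg ?i) \<mu> \<and> deg \<Lambda> \<mu> = deg \<Lambda> \<xi> - unit_deg ?i"
    proof (cases "l = 0")
      case True
      then have c: "src \<Lambda> \<mu> = rng \<Lambda> \<beta>" "\<xi> = cmp \<Lambda> \<mu> \<beta>" using cmp by auto
      have "\<xi> = cmp \<Lambda> (rng \<Lambda> \<mu>) (cmp \<Lambda> \<mu> \<beta>)"
        using cmp_rng_left[OF \<xi>] c \<mu> \<beta> by (simp add: rng_cmp)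
      then have "segment \<Lambda> \<xi> 0 \<mu>"
        unfolding segment_def using c \<mu> \<beta> rng_mor src_rng deg_rng by blast
      then show ?thesis using True deg_cmp[OF \<mu> \<beta>(1) c(1)] c(2) \<beta>(2) by simp
    next
      case False
      then have c: "src \<Lambda> \<beta> = rng \<Lambda> \<mu>" "\<xi> = cmp \<Lambda> \<beta> \<mu>" using cmp by auto
      have "\<xi> = cmp \<Lambda> \<beta> (cmp \<Lambda> \<mu> (src \<Lambda> \<mu>))"
        using cmp_src_right[OF \<mu>] c by simp
      then have "segment \<Lambda> \<xi> (unit_deg ?i) \<mu>"
        unfolding segment_def using c \<mu> \<beta> src_mor rng_src by metis
      then show ?thesis using False deg_cmp[OF \<beta>(1) \<mu> c(1)] c(2) \<beta>(2) by simp
    qed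
    then show ?thesis
      unfolding direction_face_def using subcube_eqI by blast
  qed
  have "\<exists>\<nu>. is_face k \<Lambda> r l j \<xi> \<nu>"
  proof -
    have deg: "deg \<Lambda> \<xi> = (deg \<Lambda> \<xi> - unit_deg ?i) + unit_deg ?i"
      using i by (auto simp: fun_eq_iff unit_deg_def directions_def)
    have cube: "\<nu> \<in> cubes k \<Lambda> (r - 1)" if "\<nu> \<in> mor \<Lambda>" "deg \<Lambda> \<nu> = deg \<Lambda> \<xi> - unit_deg ?i" for \<nu>
    proof -
      have "deg \<Lambda> \<nu> = deg \<Lambda> (direction_face \<Lambda> \<xi> l ?i)"
        using that(2) deg_direction_face[OF assms(1) i] by simp
      then show ?thesis
        using direction_face_cube[OF assms(1) i, of l] that(1) by (simp add: cubes_def)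
    qed
    show ?thesis
    proof (cases "l = 0")
      case True
      obtain \<nu> \<beta> where "\<nu> \<in> mor \<Lambda>" "\<beta> \<in> mor \<Lambda>" "deg \<Lambda> \<nu> = deg \<Lambda> \<xi> - unit_deg ?i"
        "deg \<Lambda> \<beta> = unit_deg ?i" "src \<Lambda> \<nu> = rng \<Lambda> \<beta>" "\<xi> = cmp \<Lambda> \<nu> \<beta>"
        using factor_ex[OF \<xi> deg] .
      then show ?thesis using True cube unfolding is_face_def by auto
    next
      case False
      have deg': "deg \<Lambda> \<xi> = unit_deg ?i + (deg \<Lambda> \<xi> - unit_deg ?i)"
        using deg by (metis add.commute)
      obtain \<beta> \<nu> where "\<beta> \<in> mor \<Lambda>" "\<nu> \<in> mor \<Lambda>" "deg \<Lambda> \<beta> = unit_deg ?i"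
        "deg \<Lambda> \<nu> = deg \<Lambda> \<xi> - unit_deg ?i" "src \<Lambda> \<beta> = rng \<Lambda> \<nu>" "\<xi> = cmp \<Lambda> \<beta> \<nu>"
        using factor_ex[OF \<xi> deg'] .
      then show ?thesis using False cube unfolding is_face_def by auto
    qed
  qed
  then show ?thesis using unique by metis
qed

lemma face_eq_direction_face:
  assumes "\<xi> \<in> cubes k \<Lambda> r" "j \<in> {1..r}"
  shows "face k \<Lambda> r l j \<xi> = direction_face \<Lambda> \<xi> l (cube_dir \<Lambda> \<xi> j)"
  unfolding face_eq_The_is_face is_face_iff[OF assms] by simp

section \<open>The boundary of a boundary of cubes\<close>

lemma cube_boundary_directions:
  assumes "\<xi> \<in> cubes k \<Lambda> r"
  shows "cube_boundary k \<Lambda> r \<xi>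
    = (\<Sum>(i, l)\<in>directions \<Lambda> \<xi> \<times> {0..1}.
         frag_cmul ((-1) ^ (Suc (card {j \<in> directions \<Lambda> \<xi>. j < i}) + l))
           (frag_of (direction_face \<Lambda> \<xi> l i)))"
proof -
  let ?D = "directions \<Lambda> \<xi>"
  let ?t = "\<lambda>l i. frag_cmul ((-1) ^ (Suc (card {j \<in> ?D. j < i}) + l)) (frag_of (direction_face \<Lambda> \<xi> l i))"
  have D: "finite ?D" "card ?D = r"
    using assms finite_directions by (auto simp: cubes_iff_card_directions)
  have dir: "cube_dir \<Lambda> \<xi> = (\<lambda>j. sorted_list_of_set ?D ! (j - 1))"
    by (simp add: fun_eq_iff cube_dir_def directions_def)
  have bij: "bij_betw (cube_dir \<Lambda> \<xi>) {1..r} ?D"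
    unfolding dir using bij_betw_sorted_list_of_set[OF D(1)] D(2) by simp
  have "(\<Sum>j = 1..r. frag_cmul ((-1) ^ (j + l)) (frag_of (face k \<Lambda> r l j \<xi>))) = (\<Sum>i\<in>?D. ?t l i)" for l
  proof (rule sum.reindex_bij_betw[OF bij, symmetric, THEN trans, symmetric])
    show "(\<Sum>j = 1..r. ?t l (cube_dir \<Lambda> \<xi> j))
        = (\<Sum>j = 1..r. frag_cmul ((-1) ^ (j + l)) (frag_of (face k \<Lambda> r l j \<xi>)))"
    proof (rule sum.cong[OF refl])
      fix j assume j: "j \<in> {1..r}"
      then have "card {i \<in> ?D. i < cube_dir \<Lambda> \<xi> j} = j - 1"
        unfolding dir using D by (intro card_less_nth_sorted_list_of_set) auto
      then show "?t l (cube_dir \<Lambda> \<xi> j) = frag_cmul ((-1) ^ (j + l)) (frag_of (face k \<Lambda> r l j \<xi>))"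
        using face_eq_direction_face[OF assms j, of l] j by simp
    qed
  qed
  then have "cube_boundary k \<Lambda> r \<xi> = (\<Sum>l = 0..1. \<Sum>i\<in>?D. ?t l i)"
    by (simp add: cube_boundary_def)
  also have "\<dots> = (\<Sum>i\<in>?D. \<Sum>l = 0..1. ?t l i)" by (rule sum.swap)
  also have "\<dots> = (\<Sum>(i, l)\<in>?D \<times> {0..1}. ?t l i)" by (rule sum.cartesian_product)
  finally show ?thesis .
qed

lemma direction_face_commute:
  assumes "\<xi> \<in> cubes k \<Lambda> r" "i \<in> directions \<Lambda> \<xi>" "j \<in> directions \<Lambda> \<xi>" "i \<noteq> j"
  shows "direction_face \<Lambda> (direction_face \<Lambda> \<xi> l i) m j = direction_face \<Lambda> (direction_face \<Lambda> \<xi> m j) l i"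
proof -
  let ?s = "\<lambda>l i. if l = (0::nat) then 0 else unit_deg i"
  have \<xi>: "\<xi> \<in> mor \<Lambda>" using assms(1) by (simp add: cubes_def)
  have twice: "direction_face \<Lambda> (direction_face \<Lambda> \<xi> l i) m j
      = subcube \<Lambda> \<xi> (?s l i + ?s m j) (deg \<Lambda> \<xi> - unit_deg i - unit_deg j)"
    if i: "i \<in> directions \<Lambda> \<xi>" and j: "j \<in> directions \<Lambda> \<xi>" "i \<noteq> j" for l i m j
  proof -
    have "?s l i + (deg \<Lambda> \<xi> - unit_deg i) \<le> deg \<Lambda> \<xi>"
      using i by (auto simp: le_fun_def unit_deg_def directions_def)
    moreover have "?s m j + (deg \<Lambda> \<xi> - unit_deg i - unit_deg j) \<le> deg \<Lambda> \<xi> - unit_deg i"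
      using j by (auto simp: le_fun_def unit_deg_def directions_def)
    ultimately show ?thesis
      using subcube_subcube[OF \<xi>] deg_direction_face[OF assms(1) i, of l]
      by (simp add: direction_face_def)
  qed
  have "deg \<Lambda> \<xi> - unit_deg i - unit_deg j = deg \<Lambda> \<xi> - unit_deg j - unit_deg i"
    by (simp add: fun_eq_iff add.commute)
  then show ?thesis
    using twice[OF assms(2-4)] twice[OF assms(3,2) assms(4)[symmetric]]
    by (simp only: add.commute)
qed

lemma antisymmetric_double_sum_zero:
  fixes K :: "'i \<Rightarrow> 'i \<Rightarrow> 'c \<Rightarrow>\<^sub>0 int"
  assumes "\<And>a b. a \<in> A \<Longrightarrow> b \<in> A \<Longrightarrow> K a b = - K b a"
  shows "(\<Sum>a\<in>A. \<Sum>b\<in>A. K a b) = 0"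
proof -
  let ?x = "\<Sum>a\<in>A. \<Sum>b\<in>A. K a b"
  have "?x = (\<Sum>b\<in>A. \<Sum>a\<in>A. K a b)" by (rule sum.swap)
  also have "\<dots> = (\<Sum>b\<in>A. \<Sum>a\<in>A. - K b a)" by (intro sum.cong refl) (rule assms)
  also have "\<dots> = - ?x" by (simp add: sum_negf)
  finally have "?x + ?x = 0" by (simp only: eq_neg_iff_add_eq_0)
  \<comment> \<open>free abelian groups have no 2-torsion\<close>
  then have "frag_cmul (1 + 1) ?x = 0" by (simp only: frag_cmul_distrib frag_cmul_one)
  then show ?thesis by simp
qed

text \<open>
  Removing the smaller of two elements moves the larger one down by one position, whereas removing the
  larger one does not move the smaller one.
\<close>
lemma alternating_sign_swap:
  fixes D :: "nat set"
  assumes "finite D" "i \<in> D" "j \<in> D" "i \<noteq> j"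
  shows "(-1) ^ (card {a \<in> D. a < i} + card {a \<in> D - {i}. a < j})
       = - ((-1) ^ (card {a \<in> D. a < j} + card {a \<in> D - {j}. a < i}) :: int)"
proof -
  have *: "(-1) ^ (card {a \<in> D. a < i} + card {a \<in> D - {i}. a < j})
       = - ((-1) ^ (card {a \<in> D. a < j} + card {a \<in> D - {j}. a < i}) :: int)"
    if "i \<in> D" "i < j" for i j
  proof -
    have "{a \<in> D. a < j} = insert i {a \<in> D - {i}. a < j}" using that by auto
    then have "card {a \<in> D. a < j} = Suc (card {a \<in> D - {i}. a < j})"
      using assms(1) by simp
    moreover have "{a \<in> D - {j}. a < i} = {a \<in> D. a < i}" using that by auto
    ultimately show ?thesis by (simp add: add.commute)
  qed
  show ?thesis using *[of i j] *[of j i] assms by (cases "i < j") auto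
qed

lemma cube_boundary_closed:
  assumes "\<xi> \<in> cubes k \<Lambda> (Suc r)"
  shows "cube_boundary k \<Lambda> (Suc r) \<xi> \<in> int_chains (cubes k \<Lambda> r)"
  unfolding cube_boundary_directions[OF assms]
proof (rule chains_sum, clarify, rule chains_cmul)
  show "frag_of (direction_face \<Lambda> \<xi> l i) \<in> int_chains (cubes k \<Lambda> r)"
    if "i \<in> directions \<Lambda> \<xi>" for i l
    using direction_face_cube[OF assms that, of l] by simp
qed

text \<open>
  The double boundary is a sum over ordered pairs of distinct directions with a choice of front or back
  for each. The two orders give the same iterated face with opposite signs.
\<close>
lemma cube_boundary_boundary:
  assumes \<xi>: "\<xi> \<in> cubes k \<Lambda> (Suc (Suc r))"
  shows "frag_extend (cube_boundary k \<Lambda> (Suc r)) (cube_boundary k \<Lambda> (Suc (Suc r)) \<xi>) = 0"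
proof -
  let ?D = "directions \<Lambda> \<xi>"
  let ?A = "?D \<times> {0..1::nat}"
  define sign :: "nat \<Rightarrow> nat \<Rightarrow> int"
    where "sign i j = (-1) ^ (card {a \<in> ?D. a < i} + card {a \<in> ?D - {i}. a < j})" for i j
  define K where "K a b = (if fst a = fst b then 0 else
      frag_cmul (sign (fst a) (fst b) * (-1) ^ (snd a + snd b))
        (frag_of (direction_face \<Lambda> (direction_face \<Lambda> \<xi> (snd a) (fst a)) (snd b) (fst b))))" for a b
  have finD: "finite ?D" using \<xi> finite_directions by (simp add: cubes_def)
  have inner: "frag_extend (cube_boundary k \<Lambda> (Suc r))
      (frag_cmul ((-1) ^ (Suc (card {j \<in> ?D. j < i}) + l)) (frag_of (direction_face \<Lambda> \<xi> l i)))
      = (\<Sum>b\<in>?A. K (i, l) b)" if i: "i \<in> ?D" for i l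
  proof -
    let ?\<mu> = "direction_face \<Lambda> \<xi> l i"
    let ?t = "\<lambda>(j, m). frag_cmul ((-1) ^ (Suc (card {a \<in> ?D. a < i}) + l))
        (frag_cmul ((-1) ^ (Suc (card {a \<in> ?D - {i}. a < j}) + m)) (frag_of (direction_face \<Lambda> ?\<mu> m j)))"
    have \<mu>: "?\<mu> \<in> cubes k \<Lambda> (Suc r)" "directions \<Lambda> ?\<mu> = ?D - {i}"
      using direction_face_cube[OF \<xi> i, of l] directions_direction_face[OF \<xi> i] by simp_all
    have "frag_extend (cube_boundary k \<Lambda> (Suc r))
      (frag_cmul ((-1) ^ (Suc (card {j \<in> ?D. j < i}) + l)) (frag_of ?\<mu>)) = (\<Sum>b\<in>(?D - {i}) \<times> {0..1}. ?t b)"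
      unfolding frag_extend_cmul frag_extend_of cube_boundary_directions[OF \<mu>(1)] \<mu>(2)
        frag_cmul_sum
      by (rule sum.cong) auto
    also have "\<dots> = (\<Sum>b\<in>(?D - {i}) \<times> {0..1}. K (i, l) b)"
      by (rule sum.cong) (auto simp: K_def sign_def power_add mult_ac)
    also have "\<dots> = (\<Sum>b\<in>?A. K (i, l) b)"
      using finD by (intro sum.mono_neutral_left) (auto simp: K_def)
    finally show ?thesis .
  qed
  have "frag_extend (cube_boundary k \<Lambda> (Suc r)) (cube_boundary k \<Lambda> (Suc (Suc r)) \<xi>)
      = (\<Sum>a\<in>?A. \<Sum>b\<in>?A. K a b)"
    unfolding cube_boundary_directions[OF \<xi>]
    using finD inner by (subst frag_extend_sum) (auto intro!: sum.cong)
  also have "\<dots> = 0"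
  proof (rule antisymmetric_double_sum_zero)
    fix a b assume "a \<in> ?A" "b \<in> ?A"
    then show "K a b = - K b a"
      using alternating_sign_swap[OF finD, of "fst a" "fst b"]
        direction_face_commute[OF \<xi>, of "fst a" "fst b" "snd a" "snd b"]
      by (auto simp: K_def sign_def add.commute simp flip: minus_frag_cmul)
  qed
  finally show ?thesis .
qed

lemma cube_boundary_augmentation:
  assumes "\<xi> \<in> cubes k \<Lambda> (Suc 0)"
  shows "push (\<lambda>_. ()) (cube_boundary k \<Lambda> (Suc 0) \<xi>) = 0"
  by (simp add: cube_boundary_def push_add push_cmul push_minus push_diff)

end

section \<open>Acyclicity and exactness\<close>

text \<open>
  The unit of a quotient group is the subgroup itself, so in a trivial quotient every cycle lies in the
  coset of the boundaries.
\<close>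
lemma trivial_chain_homologyD:
  assumes "trivial_group (chain_homology B bd r)" "c \<in> chain_cycles B bd r"
  shows "c \<in> chain_boundaries B bd r"
proof -
  have "chain_boundaries B bd r #>\<^bsub>cycle_group B bd r\<^esub> c \<in> carrier (chain_homology B bd r)"
    using assms(2) by (auto simp: chain_homology_def carrier_FactGroup carrier_cycle_group)
  also have "\<dots> = {chain_boundaries B bd r}"
    using assms(1) by (simp add: trivial_group_def chain_homology_def)
  finally have "{b + c | b. b \<in> chain_boundaries B bd r} = chain_boundaries B bd r"
    by (simp add: chain_homology_coset)
  moreover have "0 + c \<in> {b + c | b. b \<in> chain_boundaries B bd r}"
    using chain_boundaries_zero by blast
  ultimately show ?thesis by simp
qed

lemma cyclic_chain_homology_generator:
  assumes sub: "chain_boundaries B bd r \<subseteq> chain_cycles B bd r"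
    and iso: "chain_homology B bd r \<cong> integer_group"
  shows "\<exists>u\<in>chain_cycles B bd r. \<forall>c\<in>chain_cycles B bd r.
           \<exists>n. c - frag_cmul n u \<in> chain_boundaries B bd r"
proof -
  let ?Z = "cycle_group B bd r" and ?B = "chain_boundaries B bd r"
  interpret N: normal ?B ?Z by (rule normal_chain_boundaries[OF sub])
  have grp: "group (?Z Mod ?B)" by (rule N.factorgroup_is_group)
  obtain \<psi> where \<psi>: "\<psi> \<in> iso integer_group (?Z Mod ?B)"
    using iso group.iso_sym[OF _ iso] grp by (auto simp: chain_homology_def is_iso_def)
  interpret \<psi>: group_hom integer_group "?Z Mod ?B" \<psi>
    using \<psi> grp by (simp add: group_hom_def group_hom_axioms_def iso_def)
  obtain u where u: "u \<in> chain_cycles B bd r" "\<psi> 1 = ?B #>\<^bsub>?Z\<^esub> u"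
    using \<psi>.hom_closed[of 1] by (auto simp: carrier_FactGroup carrier_cycle_group)
  have mult: "\<psi> n = ?B #>\<^bsub>?Z\<^esub> frag_cmul n u" for n
  proof -
    have "u \<in> carrier ?Z" using u by (simp add: carrier_cycle_group)
    then have "?B #>\<^bsub>?Z\<^esub> u [^]\<^bsub>?Z\<^esub> n = (?B #>\<^bsub>?Z\<^esub> u) [^]\<^bsub>?Z Mod ?B\<^esub> n"
      by (rule N.FactGroup_int_pow[symmetric])
    also have "\<dots> = \<psi> (1 [^]\<^bsub>integer_group\<^esub> n)"
      unfolding u(2)[symmetric] by (rule \<psi>.hom_int_pow[symmetric]) simp
    also have "\<dots> = \<psi> n" by simp
    also have "u [^]\<^bsub>?Z\<^esub> n = frag_cmul n u"
      using u(1) by (simp add: chain_cycles_iff int_chains_def group.int_pow_subgroup_generated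
          carrier_cycle_group)
    finally show ?thesis ..
  qed
  show ?thesis
  proof (rule bexI[OF _ u(1)], rule ballI)
    fix c assume "c \<in> chain_cycles B bd r"
    then have "?B #>\<^bsub>?Z\<^esub> c \<in> carrier (?Z Mod ?B)"
      by (auto simp: carrier_FactGroup carrier_cycle_group)
    also have "carrier (?Z Mod ?B) = \<psi> ` carrier integer_group"
      using \<psi> by (simp add: iso_def bij_betw_def)
    finally obtain n where "?B #>\<^bsub>?Z\<^esub> c = \<psi> n" by (rule imageE)
    then show "\<exists>n. c - frag_cmul n u \<in> ?B"
      unfolding mult chain_homology_coset_eq_iff ..
  qed
qed

lemma (in kgraph) cube_boundaries_subset_cycles:
  "chain_boundaries (cubes k \<Lambda>) (cube_boundary k \<Lambda>) r
     \<subseteq> chain_cycles (cubes k \<Lambda>) (cube_boundary k \<Lambda>) r"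
proof
  fix b assume "b \<in> chain_boundaries (cubes k \<Lambda>) (cube_boundary k \<Lambda>) r"
  then obtain c where c: "c \<in> int_chains (cubes k \<Lambda> (Suc r))"
    and b: "b = frag_extend (cube_boundary k \<Lambda> (Suc r)) c"
    by (auto simp: chain_boundaries_eq)
  have "frag_extend (cube_boundary k \<Lambda> r) b = 0"
  proof (cases r)
    case 0
    then show ?thesis by (auto simp: cube_boundary_def intro: frag_extend_eq_0)
  next
    case (Suc m)
    then show ?thesis
      unfolding b frag_extend_frag_extend
      using cube_boundary_boundary by (intro frag_extend_zero_chains[OF c]) simp
  qed
  moreover have "b \<in> int_chains (cubes k \<Lambda> r)"
    unfolding b by (rule chains_frag_extend[OF c cube_boundary_closed])
  ultimately show "b \<in> chain_cycles (cubes k \<Lambda>) (cube_boundary k \<Lambda>) r"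
    by (simp add: chain_cycles_iff)
qed

lemma (in kgraph) push_unit_cube_boundary:
  assumes "c \<in> int_chains (cubes k \<Lambda> (Suc 0))"
  shows "push (\<lambda>_. ()) (frag_extend (cube_boundary k \<Lambda> (Suc 0)) c) = 0"
  unfolding push_frag_extend by (rule frag_extend_zero_chains[OF assms cube_boundary_augmentation])

lemma (in kgraph) cubes_0_nonempty: "cubes k \<Lambda> 0 \<noteq> {}"
proof -
  obtain \<xi> where "\<xi> \<in> mor \<Lambda>" using nonempty by blast
  then have "rng \<Lambda> \<xi> \<in> cubes k \<Lambda> 0"
    using rng_mor deg_rng by (auto simp: cubes_def deg_size_def le_fun_def)
  then show ?thesis by blast
qed

text \<open>
  In degree $0$ let $u$ represent a generator of the cyclic group $H_0(\Lambda)$. The class of a vertex is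
  a multiple of that of $u$ and has augmentation $1$, so $u$ has nonzero augmentation. A $0$-chain of
  augmentation $0$ is homologous to some $n u$, and then $n = 0$.
\<close>
lemma (in kgraph) acyclic_exact:
  assumes acyclic: "kgraph_acyclic k \<Lambda>"
    and c: "c \<in> int_chains (cubes k \<Lambda> n)" "augmented_cycle (cube_boundary k \<Lambda>) n c"
  shows "c \<in> chain_boundaries (cubes k \<Lambda>) (cube_boundary k \<Lambda>) n"
proof (cases "n = 0")
  case False
  then have "trivial_group (chain_homology (cubes k \<Lambda>) (cube_boundary k \<Lambda>) n)"
    using acyclic by (simp add: kgraph_acyclic_def kgraph_homology_def)
  then show ?thesis
    by (rule trivial_chain_homologyD) (use c False in \<open>simp add: chain_cycles_iff augmented_cycle_def\<close>)
next
  case True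
  let ?e = "push (\<lambda>_. ())"
  let ?B = "chain_boundaries (cubes k \<Lambda>) (cube_boundary k \<Lambda>) 0"
  have cycles: "chain_cycles (cubes k \<Lambda>) (cube_boundary k \<Lambda>) 0 = int_chains (cubes k \<Lambda> 0)"
    by (auto simp: chain_cycles_iff cube_boundary_def intro!: frag_extend_eq_0)
  have H0: "chain_homology (cubes k \<Lambda>) (cube_boundary k \<Lambda>) 0 \<cong> integer_group"
    using acyclic by (simp add: kgraph_acyclic_def kgraph_homology_def)
  obtain u where u: "\<And>c. c \<in> int_chains (cubes k \<Lambda> 0) \<Longrightarrow> \<exists>n. c - frag_cmul n u \<in> ?B"
    using cyclic_chain_homology_generator[OF cube_boundaries_subset_cycles H0] unfolding cycles by blast
  have aug: "?e b = 0" if "b \<in> ?B" for b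
    using that push_unit_cube_boundary by (auto simp: chain_boundaries_eq)
  obtain v where "v \<in> cubes k \<Lambda> 0" using cubes_0_nonempty by blast
  then obtain m where "frag_of v - frag_cmul m u \<in> ?B" using u by (meson chains_frag_of)
  then have "frag_of () = frag_cmul m (?e u)"
    using aug by (force simp: push_diff push_cmul)
  then have "?e u \<noteq> 0" by auto
  moreover obtain n where n: "c - frag_cmul n u \<in> ?B" using u c(1) True by blast
  then have "frag_cmul n (?e u) = ?e c" using aug by (force simp: push_diff push_cmul)
  moreover have "?e c = 0" using c(2) True by (simp add: augmented_cycle_def)
  ultimately have "n = 0" by simp
  then show ?thesis using n True by simp
qed

section \<open>Cubes under a free action\<close>

context kgraph_action
begin

lemma act_mor: "g \<in> carrier G \<Longrightarrow> \<xi> \<in> mor \<Lambda> \<Longrightarrow> \<phi> g \<xi> \<in> mor \<Lambda>"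
  by (rule element_image[OF _ _ refl])

lemma act_cube: "g \<in> carrier G \<Longrightarrow> \<xi> \<in> cubes k \<Lambda> r \<Longrightarrow> \<phi> g \<xi> \<in> cubes k \<Lambda> r"
  using act_mor by (simp add: cubes_def act_deg)

lemma act_is_face:
  assumes g: "g \<in> carrier G" and \<xi>: "\<xi> \<in> cubes k \<Lambda> r" and face: "is_face k \<Lambda> r l j \<xi> \<mu>"
  shows "is_face k \<Lambda> r l j (\<phi> g \<xi>) (\<phi> g \<mu>)"
proof -
  have \<mu>: "\<mu> \<in> mor \<Lambda>" "\<mu> \<in> cubes k \<Lambda> (r - 1)" using face by (auto simp: is_face_def cubes_def)
  obtain \<beta> where \<beta>: "\<beta> \<in> mor \<Lambda>" "deg \<Lambda> \<beta> = unit_deg (cube_dir \<Lambda> \<xi> j)"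
    and cmp: "if l = 0 then src \<Lambda> \<mu> = rng \<Lambda> \<beta> \<and> \<xi> = cmp \<Lambda> \<mu> \<beta>
         else src \<Lambda> \<beta> = rng \<Lambda> \<mu> \<and> \<xi> = cmp \<Lambda> \<beta> \<mu>"
    using face unfolding is_face_def by blast
  have dir: "cube_dir \<Lambda> (\<phi> g \<xi>) j = cube_dir \<Lambda> \<xi> j"
    using \<xi> g by (simp add: cube_dir_def act_deg cubes_def)
  have "\<phi> g \<beta> \<in> mor \<Lambda>" "deg \<Lambda> (\<phi> g \<beta>) = unit_deg (cube_dir \<Lambda> \<xi> j)"
    using \<beta> g act_mor by (simp_all add: act_deg)
  moreover have "if l = 0 then src \<Lambda> (\<phi> g \<mu>) = rng \<Lambda> (\<phi> g \<beta>) \<and> \<phi> g \<xi> = cmp \<Lambda> (\<phi> g \<mu>) (\<phi> g \<beta>)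
         else src \<Lambda> (\<phi> g \<beta>) = rng \<Lambda> (\<phi> g \<mu>) \<and> \<phi> g \<xi> = cmp \<Lambda> (\<phi> g \<beta>) (\<phi> g \<mu>)"
  proof (cases "l = 0")
    case True
    then have "src \<Lambda> \<mu> = rng \<Lambda> \<beta>" "\<xi> = cmp \<Lambda> \<mu> \<beta>" using cmp by auto
    then show ?thesis
      using True act_cmp[OF g \<mu>(1) \<beta>(1)] by (simp add: act_src[OF g \<mu>(1)] act_rng[OF g \<beta>(1)])
  next
    case False
    then have "src \<Lambda> \<beta> = rng \<Lambda> \<mu>" "\<xi> = cmp \<Lambda> \<beta> \<mu>" using cmp by auto
    then show ?thesis
      using False act_cmp[OF g \<beta>(1) \<mu>(1)] by (simp add: act_src[OF g \<beta>(1)] act_rng[OF g \<mu>(1)])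
  qed
  ultimately show ?thesis
    unfolding is_face_def dir using act_cube[OF g \<mu>(2)] by blast
qed

lemma face_act:
  assumes "g \<in> carrier G" "\<xi> \<in> cubes k \<Lambda> r" "j \<in> {1..r}"
  shows "face k \<Lambda> r l j (\<phi> g \<xi>) = \<phi> g (face k \<Lambda> r l j \<xi>)"
  using act_is_face[OF assms(1,2)] is_face_iff[OF act_cube[OF assms(1,2)] assms(3)]
    is_face_iff[OF assms(2,3)] face_eq_direction_face[OF assms(2,3)]
    face_eq_direction_face[OF act_cube[OF assms(1,2)] assms(3)]
  by metis

lemma cube_boundary_act:
  assumes "g \<in> carrier G" "\<xi> \<in> cubes k \<Lambda> r"
  shows "cube_boundary k \<Lambda> r (\<phi> g \<xi>) = push (\<phi> g) (cube_boundary k \<Lambda> r \<xi>)"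
  unfolding cube_boundary_def push_sum push_cmul push_frag_of
  by (intro sum.cong refl) (simp add: face_act[OF assms])

end

context free_kgraph_action
begin

abbreviation quotient where "quotient \<equiv> kgraph_quotient \<Lambda> G \<phi>"

lemma orbit_eqI: "\<xi> \<in> mor \<Lambda> \<Longrightarrow> \<eta> \<in> orbit G \<phi> \<xi> \<Longrightarrow> orbit G \<phi> \<eta> = orbit G \<phi> \<xi>"
proof (intro equalityI subsetI)
  interpret G: group G using group_hom group_hom.axioms(1) by blast
  assume \<xi>: "\<xi> \<in> mor \<Lambda>" and "\<eta> \<in> orbit G \<phi> \<xi>"
  then obtain g where g: "g \<in> carrier G" "\<eta> = \<phi> g \<xi>" by (auto simp: orbit_def)
  show "x \<in> orbit G \<phi> \<xi>" if x: "x \<in> orbit G \<phi> \<eta>" for x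
  proof -
    obtain h where h: "h \<in> carrier G" "x = \<phi> h (\<phi> g \<xi>)" using x g by (auto simp: orbit_def)
    then have "x = \<phi> (h \<otimes> g) \<xi>" using composition_rule[OF \<xi>] g by simp
    then show ?thesis using h g unfolding orbit_def by blast
  qed
  show "x \<in> orbit G \<phi> \<eta>" if x: "x \<in> orbit G \<phi> \<xi>" for x
  proof -
    obtain h where h: "h \<in> carrier G" "x = \<phi> h \<xi>" using x by (auto simp: orbit_def)
    have "\<phi> (h \<otimes> inv g) \<eta> = \<phi> h (\<phi> (inv g) \<eta>)"
      using composition_rule[of \<eta> h "inv g"] act_mor[OF g(1) \<xi>] g h by simp
    also have "\<phi> (inv g) \<eta> = \<xi>" using orbit_sym_aux[OF g(1) \<xi>] g by simp
    finally have "x = \<phi> (h \<otimes> inv g) \<eta>" using h by simp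
    then show ?thesis using h g unfolding orbit_def by blast
  qed
qed

lemma cubes_quotient: "cubes k quotient r = orbit G \<phi> ` cubes k \<Lambda> r"
proof -
  have mor: "mor quotient = orbit G \<phi> ` mor \<Lambda>"
    by (auto simp: kgraph_quotient_def orbits_def)
  show ?thesis
    unfolding cubes_def mor using deg_orbit by auto
qed

text \<open>
  The composite of two orbits consists of the composites of all composable representatives. A face of the
  orbit of \<open>\<xi>\<close> is therefore witnessed by a factorisation of \<open>\<xi>\<close> itself, so that uniqueness is inherited
  from $\Lambda$.
\<close>
lemma is_face_quotient:
  assumes \<xi>: "\<xi> \<in> cubes k \<Lambda> r" and j: "j \<in> {1..r}"
  shows "is_face k quotient r l j (orbit G \<phi> \<xi>) X \<longleftrightarrow> X = orbit G \<phi> (face k \<Lambda> r l j \<xi>)"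
proof -
  have \<xi>_mor: "\<xi> \<in> mor \<Lambda>" using \<xi> by (simp add: cubes_def)
  have dir: "cube_dir quotient (orbit G \<phi> \<xi>) j = cube_dir \<Lambda> \<xi> j"
    by (simp add: cube_dir_def deg_orbit[OF \<xi>_mor])
  have face: "is_face k \<Lambda> r l j \<xi> \<mu> \<longleftrightarrow> \<mu> = face k \<Lambda> r l j \<xi>" for \<mu>
    using is_face_iff[OF \<xi> j] face_eq_direction_face[OF \<xi> j] by simp
  show ?thesis
  proof
    assume X: "is_face k quotient r l j (orbit G \<phi> \<xi>) X"
    then obtain \<mu>0 where \<mu>0: "\<mu>0 \<in> cubes k \<Lambda> (r - 1)" "X = orbit G \<phi> \<mu>0"
      by (auto simp: is_face_def cubes_quotient)
    obtain Y where Y: "Y \<in> mor quotient" "deg quotient Y = unit_deg (cube_dir \<Lambda> \<xi> j)"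
      "orbit G \<phi> \<xi> = (if l = 0 then cmp quotient X Y else cmp quotient Y X)"
      using X unfolding is_face_def dir by (auto split: if_splits)
    obtain \<beta>0 where \<beta>0: "\<beta>0 \<in> mor \<Lambda>" "Y = orbit G \<phi> \<beta>0"
      using Y(1) by (auto simp: kgraph_quotient_def orbits_def)
    have "\<xi> \<in> (if l = 0 then cmp quotient X Y else cmp quotient Y X)"
      using orbit_refl[OF \<xi>_mor] Y(3) by simp
    then obtain \<mu> \<beta> where \<mu>: "\<mu> \<in> X" and \<beta>: "\<beta> \<in> Y"
      and cmp: "if l = 0 then src \<Lambda> \<mu> = rng \<Lambda> \<beta> \<and> \<xi> = cmp \<Lambda> \<mu> \<beta>
         else src \<Lambda> \<beta> = rng \<Lambda> \<mu> \<and> \<xi> = cmp \<Lambda> \<beta> \<mu>"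
      by (cases "l = 0") (auto simp: kgraph_quotient_def)
    have "\<mu> \<in> cubes k \<Lambda> (r - 1)"
      using \<mu> \<mu>0 act_cube by (auto simp: orbit_def simp del: One_nat_def)
    moreover have "\<beta> \<in> mor \<Lambda>" "deg \<Lambda> \<beta> = unit_deg (cube_dir \<Lambda> \<xi> j)"
      using \<beta> \<beta>0 Y(2) deg_orbit[OF \<beta>0(1)] act_mor by (auto simp: orbit_def act_deg)
    ultimately have "is_face k \<Lambda> r l j \<xi> \<mu>"
      using cmp unfolding is_face_def by blast
    then have "\<mu> = face k \<Lambda> r l j \<xi>" by (simp only: face)
    moreover have "orbit G \<phi> \<mu> = X"
      using orbit_eqI[of \<mu>0 \<mu>] \<mu> \<mu>0 by (simp add: cubes_def)
    ultimately show "X = orbit G \<phi> (face k \<Lambda> r l j \<xi>)" by simp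
  next
    assume "X = orbit G \<phi> (face k \<Lambda> r l j \<xi>)"
    moreover define \<mu> where "\<mu> = face k \<Lambda> r l j \<xi>"
    ultimately have X: "X = orbit G \<phi> \<mu>" by simp
    have "is_face k \<Lambda> r l j \<xi> \<mu>" by (simp only: face \<mu>_def)
    then obtain \<beta> where \<mu>: "\<mu> \<in> cubes k \<Lambda> (r - 1)" and \<beta>: "\<beta> \<in> mor \<Lambda>"
      "deg \<Lambda> \<beta> = unit_deg (cube_dir \<Lambda> \<xi> j)"
      and cmp: "if l = 0 then src \<Lambda> \<mu> = rng \<Lambda> \<beta> \<and> \<xi> = cmp \<Lambda> \<mu> \<beta>
         else src \<Lambda> \<beta> = rng \<Lambda> \<mu> \<and> \<xi> = cmp \<Lambda> \<beta> \<mu>"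
      unfolding is_face_def by blast
    have \<mu>_mor: "\<mu> \<in> mor \<Lambda>" using \<mu> by (simp add: cubes_def)
    have "X \<in> cubes k quotient (r - 1)" using \<mu> X by (auto simp only: cubes_quotient)
    moreover have "orbit G \<phi> \<beta> \<in> mor quotient"
      using \<beta>(1) by (auto simp: kgraph_quotient_def orbits_def)
    moreover have "deg quotient (orbit G \<phi> \<beta>) = unit_deg (cube_dir \<Lambda> \<xi> j)"
      using deg_orbit[OF \<beta>(1)] \<beta>(2) by simp
    moreover have "if l = 0
        then src quotient X = rng quotient (orbit G \<phi> \<beta>) \<and> orbit G \<phi> \<xi> = cmp quotient X (orbit G \<phi> \<beta>)
        else src quotient (orbit G \<phi> \<beta>) = rng quotient X \<and> orbit G \<phi> \<xi> = cmp quotient (orbit G \<phi> \<beta>) X"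
    proof (cases "l = 0")
      case True
      then have "src \<Lambda> \<mu> = rng \<Lambda> \<beta>" "\<xi> = cmp \<Lambda> \<mu> \<beta>" using cmp by auto
      then show ?thesis
        using True cmp_orbit[OF \<mu>_mor \<beta>(1)] by (simp add: X src_orbit[OF \<mu>_mor] rng_orbit[OF \<beta>(1)])
    next
      case False
      then have "src \<Lambda> \<beta> = rng \<Lambda> \<mu>" "\<xi> = cmp \<Lambda> \<beta> \<mu>" using cmp by auto
      then show ?thesis
        using False cmp_orbit[OF \<beta>(1) \<mu>_mor] by (simp add: X src_orbit[OF \<beta>(1)] rng_orbit[OF \<mu>_mor])
    qed
    ultimately show "is_face k quotient r l j (orbit G \<phi> \<xi>) X"
      unfolding is_face_def dir by blast
  qed
qed

lemma cube_boundary_quotient: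
  assumes "\<xi> \<in> cubes k \<Lambda> r"
  shows "cube_boundary k quotient r (orbit G \<phi> \<xi>) = push (orbit G \<phi>) (cube_boundary k \<Lambda> r \<xi>)"
proof -
  have "face k quotient r l j (orbit G \<phi> \<xi>) = orbit G \<phi> (face k \<Lambda> r l j \<xi>)" if "j \<in> {1..r}" for l j
    unfolding face_eq_The_is_face[of k quotient] is_face_quotient[OF assms that] by simp
  then show ?thesis
    unfolding cube_boundary_def push_sum push_cmul push_frag_of
    by (intro sum.cong refl) simp
qed

lemma cube_free_resolution:
  assumes "kgraph_acyclic k \<Lambda>"
  shows "free_resolution G (cubes k \<Lambda>) \<phi> (cube_boundary k \<Lambda>)"
proof -
  interpret G: group G using group_hom group_hom.axioms(1) by blast
  show ?thesis
  proof
    show "\<phi> g \<xi> \<in> cubes k \<Lambda> n" if "g \<in> carrier G" "\<xi> \<in> cubes k \<Lambda> n" for g \<xi> n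
      by (rule act_cube[OF that])
    show "\<phi> \<one> \<xi> = \<xi>" if "\<xi> \<in> cubes k \<Lambda> n" for \<xi> n
      using that id_eq_one by (metis (no_types, lifting) cubes_def mem_Collect_eq restrict_apply')
    show "\<phi> (g \<otimes> h) \<xi> = \<phi> g (\<phi> h \<xi>)" if "g \<in> carrier G" "h \<in> carrier G" "\<xi> \<in> cubes k \<Lambda> n" for g h \<xi> n
      using that composition_rule by (simp add: cubes_def)
    show "g = \<one>" if "g \<in> carrier G" "\<xi> \<in> cubes k \<Lambda> n" "\<phi> g \<xi> = \<xi>" for g \<xi> n
      by (rule free[OF that(1) _ that(3)]) (use that(2) in \<open>simp add: cubes_def\<close>)
    show "cubes k \<Lambda> 0 \<noteq> {}" by (rule cubes_0_nonempty)
    show "cube_boundary k \<Lambda> 0 \<xi> = 0" for \<xi> by (simp add: cube_boundary_def)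
    show "cube_boundary k \<Lambda> (Suc n) \<xi> \<in> int_chains (cubes k \<Lambda> n)" if "\<xi> \<in> cubes k \<Lambda> (Suc n)" for \<xi> n
      by (rule cube_boundary_closed[OF that])
    show "cube_boundary k \<Lambda> (Suc n) (\<phi> g \<xi>) = push (\<phi> g) (cube_boundary k \<Lambda> (Suc n) \<xi>)"
      if "g \<in> carrier G" "\<xi> \<in> cubes k \<Lambda> (Suc n)" for g \<xi> n
      by (rule cube_boundary_act[OF that])
    show "augmented_cycle (cube_boundary k \<Lambda>) n (cube_boundary k \<Lambda> (Suc n) \<xi>)"
      if "\<xi> \<in> cubes k \<Lambda> (Suc n)" for \<xi> n
      using that cube_boundary_boundary cube_boundary_augmentation
      by (cases n) (simp_all add: augmented_cycle_def)
    show "\<exists>b\<in>int_chains (cubes k \<Lambda> (Suc n)). frag_extend (cube_boundary k \<Lambda> (Suc n)) b = c"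
      if "c \<in> int_chains (cubes k \<Lambda> n)" "augmented_cycle (cube_boundary k \<Lambda>) n c" for c n
      using acyclic_exact[OF assms that] by (auto simp: chain_boundaries_eq)
  qed
qed

lemma cube_coinvariants:
  assumes "kgraph_acyclic k \<Lambda>"
  shows "free_resolution_coinvariants G (cubes k \<Lambda>) \<phi> (cube_boundary k \<Lambda>)
           (cubes k quotient) (orbit G \<phi>) (cube_boundary k quotient)"
proof (intro free_resolution_coinvariants.intro cube_free_resolution[OF assms]
    free_resolution_coinvariants_axioms.intro)
  show "orbit G \<phi> ` cubes k \<Lambda> n = cubes k quotient n" for n by (simp add: cubes_quotient)
  show "orbit G \<phi> (\<phi> g \<xi>) = orbit G \<phi> \<xi>" if "g \<in> carrier G" "\<xi> \<in> cubes k \<Lambda> n" for g \<xi> n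
    by (rule orbit_eqI) (use that in \<open>auto simp: cubes_def orbit_def\<close>)
  show "\<exists>g\<in>carrier G. \<eta> = \<phi> g \<xi>"
    if "\<xi> \<in> cubes k \<Lambda> n" "\<eta> \<in> cubes k \<Lambda> n" "orbit G \<phi> \<xi> = orbit G \<phi> \<eta>" for \<xi> \<eta> n
  proof -
    have "\<eta> \<in> orbit G \<phi> \<xi>" using orbit_refl[of \<eta>] that by (simp add: cubes_def)
    then show ?thesis by (auto simp: orbit_def)
  qed
qed (rule cube_boundary_quotient)

end

section \<open>Homology of the quotient\<close>

theorem theorem4p9:
  fixes k :: nat and \<Lambda> :: "'a kgraph" and G :: "('g, 'b) monoid_scheme"
    and \<phi> :: "'g \<Rightarrow> 'a \<Rightarrow> 'a"
  assumes "kgraph k \<Lambda>"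
    and "kgraph_acyclic k \<Lambda>"
    and "group G"
    and "free_kgraph_action k \<Lambda> G \<phi>"
  shows "\<forall>r. kgraph_homology k (kgraph_quotient \<Lambda> G \<phi>) r \<cong> group_homology G r"
  unfolding kgraph_homology_def group_homology_def
  using coinvariant_homology_unique[OF free_kgraph_action.cube_coinvariants[OF assms(4,2)]
      group.bar_coinvariants[OF assms(3)]] by blast

end
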